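(* The monoid $\mathrm{Stell}_n^0$ is the quotient of $R_n^0$ by the relations $$\pi_i\pi_{i-1}\cdots\pi_1\pi_0\pi_i\equiv\pi_i\pi_{i-1}\cdots\pi_1\pi_0\qquad\text{for } i<n-1;$$ that is, the surjective morphism $\mathrm{St}^0:R_n^0\to\mathrm{Stell}_n^0$ identifies $\mathrm{Stell}_n^0$ with the quotient of $R_n^0$ by the monoid congruence generated by these relations.
   Context: Rooks of size $n$ are words $r=r_1\dots r_n$ over $\{0,\dots,n\}$ with pairwise distinct nonzero letters; $R_n$ is their set, $1_n=12\cdots n$. $R_n^0$ is the monoid presented by generators $\pi_0,\dots,\pi_{n-1}$ and relations $\pi_i^2=\pi_i$, $\pi_i\pi_{i+1}\pi_i=\pi_{i+1}\pi_i\pi_{i+1}$ ($1\le i\le n-2$), $\pi_1\pi_0\pi_1\pi_0=\pi_0\pi_1\pi_0=\pi_0\pi_1\pi_0\pi_1$, $\pi_i\pi_j=\pi_j\pi_i$ ($|i-j|\ge2$); it acts on the right on $R_n$ by $r\cdot\pi_0=0r_2\cdots r_n$ and, for $k\ge1$, $r\cdot\pi_k$ exchanges $r_k,r_{k+1}$ if $r_k<r_{k+1}$ and fixes $r$ otherwise, and every element of $R_n^0$ is $\pi_r$ for a unique rook $r$, where $\pi_r$ is characterized by $1_n\cdot\pi_r=r$. For a rook $r$ let $M(r)=\max\{i\in\{1,\dots,n\}: i\text{ does not occur in } r\}$, and let $\mathrm{St}(r)$ be obtained from $r$ by replacing by $0$ every letter smaller than $M(r)$ (if no letter of $\{1,\dots,n\}$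 is missing, $\mathrm{St}(r)=r$). Let $\mathrm{Stell}_n=\mathrm{St}(R_n)$ and $\mathrm{St}^0(\pi_r)=\pi_{\mathrm{St}(r)}$. The map $\mathrm{St}^0$ satisfies $\mathrm{St}^0(\mathrm{St}^0(x)\mathrm{St}^0(y))=\mathrm{St}^0(xy)$, so the set $\mathrm{Stell}_n^0=\{\pi_s: s\in\mathrm{Stell}_n\}$ carries a unique monoid structure making $\mathrm{St}^0:R_n^0\to\mathrm{Stell}_n^0$ a surjective monoid morphism; $\mathrm{Stell}_n^0$ denotes this monoid (the stellar monoid).
   Formalization: The relations are imposed for all i ≤ n-1 instead of i < n-1; with the printed range the claim fails, e.g. for n=2 only π_0π_0≡π_0 remains, so the quotient is R_2^0 with 7 elements, while Stell_2 has 5. *)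

theory Defs
  imports "HOL-Algebra.Group"
begin

section \<open>Monoid congruences, quotients and presentations\<close>

inductive_set mcong :: "('a, 'b) monoid_scheme \<Rightarrow> ('a \<times> 'a) set \<Rightarrow> ('a \<times> 'a) set"
  for M (structure) and S where
  base: "(x, y) \<in> S \<Longrightarrow> x \<in> carrier M \<Longrightarrow> y \<in> carrier M \<Longrightarrow> (x, y) \<in> mcong M S"
| refl: "x \<in> carrier M \<Longrightarrow> (x, x) \<in> mcong M S"
| sym: "(x, y) \<in> mcong M S \<Longrightarrow> (y, x) \<in> mcong M S"
| trans: "(x, y) \<in> mcong M S \<Longrightarrow> (y, z) \<in> mcong M S \<Longrightarrow> (x, z) \<in> mcong M S"
| mult: "(x, y) \<in> mcong M S \<Longrightarrow> (u, v) \<in> mcong M S \<Longrightarrow> (x \<otimes> u, y \<otimes> v) \<in> mcong M S"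

definition quot_monoid :: "('a, 'b) monoid_scheme \<Rightarrow> ('a \<times> 'a) set \<Rightarrow> 'a set monoid" where
  "quot_monoid M E =
     \<lparr>carrier = carrier M // E,
      mult = (\<lambda>A B. \<Union>a\<in>A. \<Union>b\<in>B. E `` {a \<otimes>\<^bsub>M\<^esub> b}),
      one = E `` {\<one>\<^bsub>M\<^esub>}\<rparr>"

definition word_monoid :: "nat \<Rightarrow> nat list monoid" where
  "word_monoid n = \<lparr>carrier = lists {..<n}, mult = (@), one = []\<rparr>"

section \<open>The 0-rook monoid\<close>

text \<open>The letter \<open>i\<close> stands for the generator \<open>\<pi>\<^sub>i\<close>, \<open>0 \<le> i < n\<close>.\<close>

definition rook_rels :: "nat \<Rightarrow> (nat list \<times> nat list) set" where
  "rook_rels n =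
     {([i, i], [i]) | i. i < n}
   \<union> {([i, i+1, i], [i+1, i, i+1]) | i. 1 \<le> i \<and> i + 1 < n}
   \<union> {(u, v). 2 \<le> n \<and> (u, v) \<in> {([1,0,1,0], [0,1,0]), ([0,1,0], [0,1,0,1])}}
   \<union> {([i, j], [j, i]) | i j. i < n \<and> j < n \<and> (i + 2 \<le> j \<or> j + 2 \<le> i)}"

definition R0 :: "nat \<Rightarrow> nat list set monoid" where
  "R0 n = quot_monoid (word_monoid n) (mcong (word_monoid n) (rook_rels n))"

text \<open>The element of the 0-rook monoid represented by a word, i.e. the product of its letters.\<close>

definition R0_class :: "nat \<Rightarrow> nat list \<Rightarrow> nat list set" where
  "R0_class n w = mcong (word_monoid n) (rook_rels n) `` {w}"

section \<open>Rooks and the right action\<close>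

definition rooks :: "nat \<Rightarrow> nat list set" where
  "rooks n = {r. length r = n \<and> set r \<subseteq> {0..n} \<and> distinct (filter (\<lambda>x. x \<noteq> 0) r)}"

definition id_rook :: "nat \<Rightarrow> nat list" where
  "id_rook n = [1..<Suc n]"

text \<open>Rooks are lists indexed from 0, so the letter \<open>r\<^sub>k\<close> is \<open>r ! (k - 1)\<close>.\<close>

definition act_gen :: "nat \<Rightarrow> nat list \<Rightarrow> nat list" where
  "act_gen k r =
     (if k = 0 then r[0 := 0]
      else if r ! (k - 1) < r ! k then r[k - 1 := r ! k, k := r ! (k - 1)]
      else r)"

text \<open>Right action: the first letter of the word acts first.\<close>

definition act_word :: "nat list \<Rightarrow> nat list \<Rightarrow> nat list" where
  "act_word r w = fold act_gen w r"

text \<open>The action respects the defining relations, so on an element of \<open>R0 n\<close> the image below is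
  a singleton.\<close>

definition act :: "nat list \<Rightarrow> nat list set \<Rightarrow> nat list" where
  "act r x = the_elem (act_word r ` x)"

definition pi_rook :: "nat \<Rightarrow> nat list \<Rightarrow> nat list set" where
  "pi_rook n r = (THE x. x \<in> carrier (R0 n) \<and> act (id_rook n) x = r)"

section \<open>The stellar monoid\<close>

definition max_missing :: "nat \<Rightarrow> nat list \<Rightarrow> nat" where
  "max_missing n r = Max {i \<in> {1..n}. i \<notin> set r}"

definition St :: "nat \<Rightarrow> nat list \<Rightarrow> nat list" where
  "St n r = (if {1..n} \<subseteq> set r then r
             else map (\<lambda>x. if x < max_missing n r then 0 else x) r)"

definition Stell :: "nat \<Rightarrow> nat list set" where
  "Stell n = St n ` rooks n"

text \<open>For \<open>x = \<pi>\<^sub>r\<close> the rook \<open>r\<close> is \<open>1\<^sub>n \<cdot> x\<close>, so this is the map \<open>\<pi>\<^sub>r \<mapsto> \<pi>\<^bsub>St(r)\<^esub>\<close>.\<close>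

definition St0 :: "nat \<Rightarrow> nat list set \<Rightarrow> nat list set" where
  "St0 n x = pi_rook n (St n (act (id_rook n) x))"

text \<open>As \<open>St0\<close> fixes every \<open>\<pi>\<^sub>s\<close> with \<open>s\<close> in \<open>Stell n\<close>, the product and unit below are the only
  ones on this set for which \<open>St0\<close> can be a monoid morphism.\<close>

definition Stell0 :: "nat \<Rightarrow> nat list set monoid" where
  "Stell0 n =
     \<lparr>carrier = pi_rook n ` Stell n,
      mult = (\<lambda>x y. St0 n (x \<otimes>\<^bsub>R0 n\<^esub> y)),
      one = St0 n \<one>\<^bsub>R0 n\<^esub>\<rparr>"

text \<open>The relations \<open>\<pi>\<^sub>i \<pi>\<^bsub>i-1\<^esub> \<dots> \<pi>\<^sub>1 \<pi>\<^sub>0 \<pi>\<^sub>i \<equiv> \<pi>\<^sub>i \<pi>\<^bsub>i-1\<^esub> \<dots> \<pi>\<^sub>1 \<pi>\<^sub>0\<close>, one for each generator \<open>\<pi>\<^sub>i\<close>.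
  The index \<open>i = n - 1\<close> has to be included: for \<open>n = 2\<close> the only other relation is
  \<open>\<pi>\<^sub>0 \<pi>\<^sub>0 \<equiv> \<pi>\<^sub>0\<close>, which already holds in \<open>R0 2\<close>, whereas \<open>St0\<close> identifies the rooks 01 and 10
  (with each other and with 00).\<close>

definition stell_rels :: "nat \<Rightarrow> (nat list set \<times> nat list set) set" where
  "stell_rels n =
     {(R0_class n (rev [0..<Suc i] @ [i]), R0_class n (rev [0..<Suc i])) | i. i < n}"

end

theory Submission
  imports Defs "HOL-Library.Multiset"
begin

text \<open>
  For \<open>k \<ge> 1\<close> the generator \<open>\<pi>\<^sub>k\<close> replaces the letters at positions \<open>k\<close>, \<open>k + 1\<close> by their maximum and
  minimum, so the action commutes with letterwise application of every monotone map fixing \<open>0\<close>, in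
  particular with truncation; hence the kernel of \<open>St0\<close> is compatible with right multiplication.
  After \<open>\<pi>\<^sub>i \<dots> \<pi>\<^sub>0\<close> the maximum of the first \<open>i + 1\<close> letters is missing, so these letters are all
  truncated and the stellar relations hold in the kernel. Conversely, the stellar relations let
  \<open>\<pi>\<^sub>i \<dots> \<pi>\<^sub>0\<close> absorb every word in \<open>\<pi>\<^sub>0, \<dots>, \<pi>\<^sub>i\<close> on its right, and for a rook \<open>r\<close> with largest missing
  letter \<open>m\<close> this deforms \<open>\<pi>\<^sub>r\<close>, which is left divisible by \<open>\<pi>\<^bsub>m-1\<^esub> \<dots> \<pi>\<^sub>0\<close>, into \<open>\<pi>\<^bsub>St(r)\<^esub>\<close>.
  That \<open>\<pi>\<^sub>r\<close> is well defined is shown by induction on \<open>n\<close>, with normal forms along the cosets of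
  \<open>R0 n\<close> in \<open>R0 (n + 1)\<close>.
\<close>

section \<open>Quotients by generated congruences\<close>

context monoid
begin

lemma mcong_carrier:
  assumes "(x, y) \<in> mcong G S"
  shows "x \<in> carrier G \<and> y \<in> carrier G"
  using assms by induction auto

lemma equiv_mcong: "equiv (carrier G) (mcong G S)"
proof (rule equivI)
  show "refl_on (carrier G) (mcong G S)"
    by (auto simp: refl_on_def mcong.refl)
  show "mcong G S \<subseteq> carrier G \<times> carrier G"
    using mcong_carrier by auto
qed (auto intro!: symI transI intro: mcong.sym mcong.trans)

lemma mcong_class_eq_iff:
  assumes "x \<in> carrier G" "y \<in> carrier G"
  shows "mcong G S `` {x} = mcong G S `` {y} \<longleftrightarrow> (x, y) \<in> mcong G S"
  using eq_equiv_class_iff[OF equiv_mcong assms] .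

lemma carrier_quot_monoid:
  "carrier (quot_monoid G (mcong G S)) = (\<lambda>x. mcong G S `` {x}) ` carrier G"
  by (auto simp: quot_monoid_def quotient_def)

lemma quot_monoid_mult:
  assumes "x \<in> carrier G" "y \<in> carrier G"
  shows "mcong G S `` {x} \<otimes>\<^bsub>quot_monoid G (mcong G S)\<^esub> mcong G S `` {y}
    = mcong G S `` {x \<otimes> y}"
proof -
  let ?E = "mcong G S"
  have "?E `` {a \<otimes> b} = ?E `` {x \<otimes> y}" if "a \<in> ?E `` {x}" "b \<in> ?E `` {y}" for a b
    using that mcong.mult equiv_class_eq[OF equiv_mcong] by (metis Image_singleton_iff)
  then have "(\<Union>a\<in>?E `` {x}. \<Union>b\<in>?E `` {y}. ?E `` {a \<otimes> b})
    = (\<Union>a\<in>?E `` {x}. \<Union>b\<in>?E `` {y}. ?E `` {x \<otimes> y})"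
    by (intro SUP_cong) simp_all
  \<comment> \<open>Nonempty index sets keep the union of a constant family from collapsing to the
    empty set.\<close>
  moreover have "x \<in> ?E `` {x}" "y \<in> ?E `` {y}"
    using assms by (simp_all add: mcong.refl)
  then have "?E `` {x} \<noteq> {}" "?E `` {y} \<noteq> {}"
    by blast+
  ultimately show ?thesis
    by (simp add: quot_monoid_def)
qed

lemma monoid_quot_monoid: "monoid (quot_monoid G (mcong G S))"
proof -
  have one: "\<one>\<^bsub>quot_monoid G (mcong G S)\<^esub> = mcong G S `` {\<one>}"
    by (simp add: quot_monoid_def)
  show ?thesis
    by unfold_locales
      (auto simp: one carrier_quot_monoid quot_monoid_mult m_assoc)
qed

end

section \<open>The action on lists\<close>

lemma length_act_gen [simp]: "length (act_gen k r) = length r"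
  by (simp add: act_gen_def)

lemma act_word_Nil [simp]: "act_word r [] = r"
  by (simp add: act_word_def)

lemma act_word_Cons [simp]: "act_word r (k # w) = act_word (act_gen k r) w"
  by (simp add: act_word_def)

lemma act_word_append [simp]: "act_word r (u @ v) = act_word (act_word r u) v"
  by (simp add: act_word_def)

lemma length_act_word [simp]: "length (act_word r w) = length r"
  by (induction w arbitrary: r) auto

lemma act_gen_0_Cons [simp]: "act_gen 0 (x # r) = 0 # r"
  by (simp add: act_gen_def)

text \<open>With \<open>max\<close> and \<open>min\<close> in place of the comparison, one formula
  covers both cases of the definition, and monotone maps commute with it.\<close>

lemma act_gen_swap:
  "k = Suc (length a) \<Longrightarrow> act_gen k (a @ x # y # b) = a @ max x y # min x y # b"
  by (auto simp: act_gen_def nth_append list_update_append)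

lemma split_two:
  assumes "0 < k" "k < length r"
  obtains a x y b where "r = a @ x # y # b" "k = Suc (length a)"
proof
  show "r = take (k - 1) r @ r ! (k - 1) # r ! k # drop (Suc k) r"
    using assms by (metis Cons_nth_drop_Suc Suc_diff_1 append_take_drop_id less_imp_diff_less)
  show "k = Suc (length (take (k - 1) r))"
    using assms by simp
qed

lemma act_gen_append: "k < length a \<Longrightarrow> act_gen k (a @ b) = act_gen k a @ b"
  by (auto simp: act_gen_def nth_append list_update_append split: if_splits)

text \<open>The letter \<open>k\<close> touches only the indices \<open>k - 1\<close> and
  \<open>k\<close>, so these words never reach \<open>b\<close>.\<close>

lemma act_word_append_left:
  "w \<in> lists {..<length a} \<Longrightarrow> act_word (a @ b) w = act_word a w @ b"
proof (induction w arbitrary: a)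
  case (Cons k w)
  then show ?case
    using Cons.IH[of "act_gen k a"] by (simp add: act_gen_append)
qed simp

lemma map_act_gen:
  assumes "mono f" "f 0 = 0" "k < length r"
  shows "map f (act_gen k r) = act_gen k (map f r)"
proof (cases k)
  case 0
  then show ?thesis
    using assms by (cases r) auto
next
  case (Suc k')
  with assms(3) obtain a x y b where "r = a @ x # y # b" "k = Suc (length a)"
    using split_two[of k r] by blast
  then show ?thesis
    using assms(1,2) by (simp add: act_gen_swap max_of_mono min_of_mono)
qed

lemma map_act_word:
  assumes "mono f" "f 0 = 0"
  shows "w \<in> lists {..<length r} \<Longrightarrow> map f (act_word r w) = act_word (map f r) w"
  by (induction w arbitrary: r) (auto simp: map_act_gen assms)

lemma mset_act_gen: "0 < k \<Longrightarrow> k < length r \<Longrightarrow> mset (act_gen k r) = mset r"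
  by (elim split_two) (auto simp: act_gen_swap max_def min_def)

lemma set_act_gen_pos: "0 < k \<Longrightarrow> k < length r \<Longrightarrow> set (act_gen k r) = set r"
  using mset_act_gen mset_eq_setD by blast

lemma set_act_gen:
  assumes "k < length r"
  shows "set (act_gen k r) \<subseteq> insert 0 (set r)"
  using assms by (cases "k = 0"; cases r) (auto simp: set_act_gen_pos)

lemma set_act_word:
  "w \<in> lists {..<length r} \<Longrightarrow> set (act_word r w) \<subseteq> insert 0 (set r)"
proof (induction w arbitrary: r)
  case (Cons k w)
  then show ?case
    using Cons.IH[of "act_gen k r"] set_act_gen[of k r] by fastforce
qed auto

section \<open>Stability of the set of rooks under the action\<close>

lemma distinct_filter_mset_cong:
  "mset r = mset r' \<Longrightarrow> distinct (filter P r) = distinct (filter P r')"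
  by (metis mset_filter mset_eq_imp_distinct_iff)

lemma act_gen_rooks:
  assumes "r \<in> rooks n" "k < n"
  shows "act_gen k r \<in> rooks n"
proof -
  have "distinct (filter (\<lambda>x. x \<noteq> 0) (act_gen k r))"
  proof (cases "k = 0")
    case True
    with assms show ?thesis
      by (cases r) (auto simp: rooks_def split: if_splits)
  next
    case False
    then show ?thesis
      using assms distinct_filter_mset_cong[OF mset_act_gen, of k r "\<lambda>x. x \<noteq> 0"]
      by (auto simp: rooks_def)
  qed
  moreover have "set (act_gen k r) \<subseteq> {0..n}"
    using assms set_act_gen[of k r] by (auto simp: rooks_def)
  ultimately show ?thesis
    using assms by (simp add: rooks_def)
qed

lemma act_word_rooks: "r \<in> rooks n \<Longrightarrow> w \<in> lists {..<n} \<Longrightarrow> act_word r w \<in> rooks n"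
  by (induction w arbitrary: r) (auto simp: act_gen_rooks)

lemma length_id_rook [simp]: "length (id_rook n) = n"
  by (simp add: id_rook_def)

lemma id_rook_in_rooks: "id_rook n \<in> rooks n"
  by (auto simp: rooks_def id_rook_def simp del: upt_Suc)

lemma id_rook_Suc: "id_rook (Suc n) = id_rook n @ [Suc n]"
  by (simp add: id_rook_def)

lemma set_act_word_id_rook:
  "w \<in> lists {..<n} \<Longrightarrow> set (act_word (id_rook n) w) \<subseteq> {0..n}"
  using act_word_rooks[OF id_rook_in_rooks] by (auto simp: rooks_def)

section \<open>Moving a maximal last letter\<close>

text \<open>No letter of \<open>b\<close> exceeds \<open>x\<close>, so every generator of the
  descending word moves \<open>x\<close> one place to the left. The induction peels off the last
  letter of \<open>b\<close>, which \<open>x\<close> passes first.\<close>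

lemma act_word_down:
  assumes "\<forall>y\<in>set b. y \<le> x"
  shows "act_word (a @ b @ [x]) (rev [Suc (length a)..<Suc (length a + length b)]) = a @ x # b"
  using assms
proof (induction b rule: rev_induct)
  case (snoc y b)
  have "act_gen (length a + length (b @ [y])) (a @ (b @ [y]) @ [x]) = (a @ b @ [x]) @ [y]"
    using snoc.prems act_gen_swap[of "Suc (length a + length b)" "a @ b" y x "[]"] by simp
  then have "act_word (a @ (b @ [y]) @ [x]) (rev [Suc (length a)..<Suc (length a + length (b @ [y]))])
    = act_word ((a @ b @ [x]) @ [y]) (rev [Suc (length a)..<Suc (length a + length b)])"
    by simp
  also have "\<dots> = act_word (a @ b @ [x]) (rev [Suc (length a)..<Suc (length a + length b)]) @ [y]"
    by (rule act_word_append_left) auto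
  finally show ?case
    using snoc by simp
qed simp

text \<open>The letter \<open>0\<close> is minimal, so every generator of the ascending word moves
  it one place to the right.\<close>

lemma act_word_up: "act_word (0 # c @ b) [1..<Suc (length c)] = c @ 0 # b"
proof (induction c arbitrary: b rule: rev_induct)
  case (snoc y c)
  then show ?case
    using act_gen_swap[of "Suc (length c)" c 0 y b] by simp
qed simp

lemma act_word_kill:
  assumes "\<forall>y\<in>set b. y \<le> x"
  shows "act_word (b @ [x]) (rev [0..<Suc (length b)]) = 0 # b"
proof -
  have "rev [0..<Suc (length b)] = rev [Suc 0..<Suc (length b)] @ [0]"
    by (simp add: upt_conv_Cons del: upt_Suc)
  then show ?thesis
    using act_word_down[of b x "[]"] assms by (simp del: upt_Suc)
qed

text \<open>The maximal letter is carried to the front and erased; the zero left behind then moves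
  to the chosen place.\<close>

lemma act_word_kill_up:
  assumes "\<forall>y\<in>set (c @ b). y \<le> x"
  shows "act_word (c @ b @ [x]) (rev [0..<Suc (length c + length b)] @ [1..<Suc (length c)])
    = c @ 0 # b"
  using act_word_kill[of "c @ b" x] assms act_word_up[of c b] by (simp del: upt_Suc)

text \<open>Insertion argument: sortedness makes the last letter \<open>x\<close> of the source list
  maximal. If \<open>x\<close> is nonzero and occurs in \<open>r\<close>, it is moved to its place
  there; otherwise it is erased and supplies a zero of \<open>r\<close>. The other letters of
  \<open>r\<close> are produced first, by induction.\<close>

lemma reach:
  assumes "sorted s" "length r = length s" "distinct (filter (\<lambda>x. x \<noteq> 0) r)"
    and "set r \<subseteq> insert 0 (set s)"
  shows "\<exists>v\<in>lists {..<length s}. act_word s v = r"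
  using assms
proof (induction s arbitrary: r rule: rev_induct)
  case (snoc x s)
  have s: "sorted s" "\<forall>y\<in>set s. y \<le> x"
    using snoc.prems by (auto simp: sorted_append)
  \<comment> \<open>Common end of both cases: \<open>z\<close> is what becomes of \<open>x\<close>,
    the list \<open>a @ b\<close> is reached by the induction hypothesis, and \<open>d\<close>
    supplies the word that puts \<open>z\<close> in place.\<close>
  have step: ?case if r: "r = a @ z # b" and zx: "z = x \<or> z = 0"
    and sub: "set (a @ b) \<subseteq> insert 0 (set s)"
    and d: "\<And>r'. r' = a @ b \<Longrightarrow> \<forall>y\<in>set r'. y \<le> x \<Longrightarrow> \<exists>d\<in>lists {..<Suc (length r')}. act_word (r' @ [x]) d = r"
    for a z b
  proof -
    have "\<exists>v\<in>lists {..<length s}. act_word s v = a @ b"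
      using snoc.prems(2,3) r sub s by (intro snoc.IH) (auto split: if_splits)
    then obtain v where v: "v \<in> lists {..<length s}" "act_word s v = a @ b" by blast
    have "\<forall>y\<in>set (a @ b). y \<le> x"
      using sub s by auto
    then obtain e where "e \<in> lists {..<Suc (length (a @ b))}" "act_word ((a @ b) @ [x]) e = r"
      using d by blast
    moreover have "length (a @ b) = length s"
      using snoc.prems(2) r by simp
    ultimately have "v @ e \<in> lists {..<length (s @ [x])} \<and> act_word (s @ [x]) (v @ e) = r"
      using v by (auto simp: act_word_append_left)
    then show ?thesis by blast
  qed
  show ?case
  proof (cases "x \<noteq> 0 \<and> x \<in> set r")
    case True
    then obtain a b where r: "r = a @ x # b"
      by (meson split_list)
    show ?thesis
    proof (rule step[OF r])
      show "set (a @ b) \<subseteq> insert 0 (set s)"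
        using snoc.prems(3,4) True by (auto simp: r)
      fix r' assume r': "r' = a @ b" "\<forall>y\<in>set r'. y \<le> x"
      then show "\<exists>d\<in>lists {..<Suc (length r')}. act_word (r' @ [x]) d = r"
        using act_word_down[of b x a]
        by (intro bexI[of _ "rev [Suc (length a)..<Suc (length a + length b)]"])
          (simp_all add: r subset_iff lists_eq_set del: upt_Suc)
    qed simp
  next
    case False
    \<comment> \<open>Pigeonhole: without a zero, \<open>r\<close> would consist of
      \<open>Suc (length s)\<close> distinct letters, all in \<open>set s\<close>.\<close>
    have "0 \<in> set r"
    proof (rule ccontr)
      assume z: "0 \<notin> set r"
      then have "filter (\<lambda>x. x \<noteq> 0) r = r"
        by (intro filter_True) metis
      then have "card (set r) = Suc (length s)"
        using snoc.prems(2,3) distinct_card[of r] by simp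
      moreover have "set r \<subseteq> set s"
        using z False snoc.prems(4) by auto
      then have "card (set r) \<le> length s"
        using card_mono[of "set s" "set r"] card_length[of s] by simp
      ultimately show False by simp
    qed
    then obtain a b where r: "r = a @ 0 # b"
      by (meson split_list)
    show ?thesis
    proof (rule step[OF r])
      show "set (a @ b) \<subseteq> insert 0 (set s)"
        using snoc.prems(4) False s by (auto simp: r)
      fix r' assume r': "r' = a @ b" "\<forall>y\<in>set r'. y \<le> x"
      then show "\<exists>d\<in>lists {..<Suc (length r')}. act_word (r' @ [x]) d = r"
        using act_word_kill_up[of a b x]
        by (intro bexI[of _ "rev [0..<Suc (length a + length b)] @ [1..<Suc (length a)]"])
          (simp_all add: r subset_iff lists_eq_set del: upt_Suc act_word_append)
    qed simp
  qed
qed simp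

lemma reach_rook:
  assumes "r \<in> rooks n"
  obtains v where "v \<in> lists {..<n}" "act_word (id_rook n) v = r"
proof -
  have "set r \<subseteq> insert 0 (set (id_rook n))"
    using assms by (auto simp: rooks_def id_rook_def simp del: upt_Suc)
  then show ?thesis
    using reach[of "id_rook n" r] assms that
    by (auto simp: rooks_def id_rook_def simp del: upt_Suc)
qed

section \<open>Consequences of the rook relations\<close>

lemma upt_0_split: "[0..<Suc (Suc j)] = 0 # 1 # [2..<Suc (Suc j)]"
  by (simp add: upt_conv_Cons numeral_2_eq_2 del: upt_Suc)

lemma upt_1_split: "1 < k \<Longrightarrow> [1..<k] = 1 # [2..<k]"
  by (simp add: upt_conv_Cons numeral_2_eq_2)

lemma rev_upt_0: "0 < N \<Longrightarrow> rev [0..<N] = rev [1..<N] @ [0]"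
  by (simp add: upt_conv_Cons del: upt_Suc)

text \<open>Stated for functions, the rook relations can be applied by simplification anywhere
  inside a word, without congruence bookkeeping. Since \<open>fold\<close> applies the first letter
  first, nested applications spell words backwards.\<close>

locale rook_functions =
  fixes f :: "nat \<Rightarrow> 'a \<Rightarrow> 'a" and N :: nat
  assumes idem: "i < N \<Longrightarrow> f i (f i x) = f i x"
    and braid: "1 \<le> i \<Longrightarrow> Suc i < N \<Longrightarrow> f i (f (Suc i) (f i x)) = f (Suc i) (f i (f (Suc i) x))"
    and zero_left: "2 \<le> N \<Longrightarrow> f 0 (f 1 (f 0 (f 1 x))) = f 0 (f 1 (f 0 x))"
    and zero_right: "2 \<le> N \<Longrightarrow> f 1 (f 0 (f 1 (f 0 x))) = f 0 (f 1 (f 0 x))"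
    and far: "i + 2 \<le> j \<or> j + 2 \<le> i \<Longrightarrow> i < N \<Longrightarrow> j < N \<Longrightarrow> f i (f j x) = f j (f i x)"
begin

section \<open>Moving letters through descending and ascending words\<close>

lemma far_fold:
  assumes "k < N" "\<forall>i\<in>set w. i < N \<and> (i + 2 \<le> k \<or> k + 2 \<le> i)"
  shows "f k (fold f w x) = fold f w (f k x)"
  using assms(2)
proof (induction w arbitrary: x)
  case (Cons i w)
  then show ?case
    using far[of i k] assms(1) by simp
qed simp

text \<open>Read in the word, \<open>Suc k\<close> commutes to the left past the letters below
  \<open>k\<close>, is turned into \<open>k\<close> by the braid relation, and then commutes past
  the letters above \<open>Suc k\<close>.\<close>

lemma down_shift:
  assumes "1 \<le> p" "p \<le> k" "Suc k < N"
  shows "f (Suc k) (fold f (rev [p..<N]) x) = fold f (rev [p..<N]) (f k x)"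
proof -
  have "[p..<N] = [p..<k] @ [k, Suc k] @ [Suc (Suc k)..<N]"
    using assms upt_add_eq_append[of p k "N - k"]
    by (simp add: upt_conv_Cons del: upt_Suc)
  moreover have "f (Suc k) (fold f (rev [p..<k]) y) = fold f (rev [p..<k]) (f (Suc k) y)" for y
    using assms by (intro far_fold) auto
  moreover have "fold f (rev [Suc (Suc k)..<N]) (f k y) = f k (fold f (rev [Suc (Suc k)..<N]) y)" for y
    using assms by (intro far_fold[symmetric]) auto
  ultimately show ?thesis
    using assms braid[of k] by simp
qed

text \<open>Mirror image of \<open>down_shift\<close>: on its way to the left through an ascending
  word, \<open>k\<close> is raised by the braid relation.\<close>

lemma up_shift:
  assumes "1 \<le> k" "k < j" "j < N"
  shows "f k (fold f [1..<Suc j] x) = fold f [1..<Suc j] (f (Suc k) x)"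
proof -
  have "[1..<Suc j] = [1..<k] @ [k, Suc k] @ [Suc (Suc k)..<Suc j]"
    using assms upt_add_eq_append[of 1 k "Suc j - k"]
    by (simp add: upt_conv_Cons del: upt_Suc)
  moreover have "f (Suc k) (fold f [1..<k] y) = fold f [1..<k] (f (Suc k) y)" for y
    using assms by (intro far_fold) auto
  moreover have "f k (fold f [Suc (Suc k)..<Suc j] y) = fold f [Suc (Suc k)..<Suc j] (f k y)" for y
    using assms by (intro far_fold) auto
  ultimately show ?thesis
    using assms braid[of k] by (simp del: upt_Suc)
qed

lemma up_up:
  assumes "i \<le> j" "Suc j < N"
  shows "fold f ([1..<Suc (Suc j)] @ [1..<Suc i]) x = fold f ([2..<Suc (Suc i)] @ [1..<Suc (Suc j)]) x"
  using assms(1)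
proof (induction i)
  case (Suc i)
  have "fold f ([1..<Suc (Suc j)] @ [1..<Suc (Suc i)]) x
    = f (Suc i) (fold f ([1..<Suc (Suc j)] @ [1..<Suc i]) x)"
    by simp
  also have "\<dots> = f (Suc i) (fold f [1..<Suc (Suc j)] (fold f [2..<Suc (Suc i)] x))"
    using Suc by (simp del: upt_Suc)
  also have "\<dots> = fold f [1..<Suc (Suc j)] (f (Suc (Suc i)) (fold f [2..<Suc (Suc i)] x))"
    using Suc.prems assms(2) by (intro up_shift) auto
  finally show ?case
    by simp
qed simp

text \<open>The letter \<open>0\<close> commutes to the right past all of the descending word except
  its last letter \<open>1\<close>. Each later letter passes the whole descending word and is raised
  by one, by \<open>down_shift\<close>.\<close>

lemma up_down:
  assumes "Suc j < N"
  shows "fold f ([0..<Suc j] @ rev [1..<N]) x = fold f [0..<Suc (Suc j)] (fold f (rev [2..<N]) x)"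
  using assms
proof (induction j)
  case 0
  have "[1..<N] = 1 # [2..<N]"
    using 0 by (simp add: upt_conv_Cons numeral_2_eq_2)
  moreover have "f 0 (fold f (rev [2..<N]) x) = fold f (rev [2..<N]) (f 0 x)"
    using 0 by (intro far_fold) auto
  ultimately show ?case
    by simp
next
  case (Suc j)
  have "fold f ([0..<Suc (Suc j)] @ rev [1..<N]) x
    = fold f (rev [1..<N]) (f (Suc j) (fold f [0..<Suc j] x))"
    by simp
  also have "\<dots> = f (Suc (Suc j)) (fold f (rev [1..<N]) (fold f [0..<Suc j] x))"
    using Suc.prems by (intro down_shift[symmetric]) auto
  also have "\<dots> = f (Suc (Suc j)) (fold f [0..<Suc (Suc j)] (fold f (rev [2..<N]) x))"
    using Suc by (simp del: upt_Suc)
  finally show ?case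
    by simp
qed

lemma far_0_up:
  assumes "j < N"
  shows "f 0 (fold f [2..<Suc j] x) = fold f [2..<Suc j] (f 0 x)"
  using assms by (intro far_fold) auto

text \<open>On rooks: next to an existing zero it does not matter whether the new zero is inserted
  before or after it. Algebraically, the two zeros expose a factor \<open>0, 1, 0\<close>, which
  absorbs a following \<open>1\<close> by \<open>zero_right\<close>.\<close>

lemma down_up_cancel:
  assumes "Suc j < N"
  shows "fold f ([0..<Suc j] @ rev [0..<N] @ [1..<Suc (Suc j)]) x
    = fold f ([0..<Suc j] @ rev [0..<N] @ [1..<Suc j]) x"
proof -
  define y where "y = f 0 (f 1 (f 0 (fold f (rev [2..<N]) x)))"
  have y: "f 1 y = y"
    using zero_right assms by (simp add: y_def)
  have "fold f ([0..<Suc j] @ rev [0..<N]) x = f 0 (fold f ([0..<Suc j] @ rev [1..<N]) x)"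
    using assms rev_upt_0 by (simp del: upt_Suc)
  also have "\<dots> = f 0 (fold f [2..<Suc (Suc j)] (f 1 (f 0 (fold f (rev [2..<N]) x))))"
    using up_down[OF assms, of x] by (simp add: upt_0_split del: upt_Suc)
  also have "\<dots> = fold f [2..<Suc (Suc j)] y"
    using assms by (subst far_0_up) (simp_all add: y_def del: upt_Suc)
  finally have *: "fold f ([0..<Suc j] @ rev [0..<N]) x = fold f [2..<Suc (Suc j)] y" .
  have "fold f [1..<Suc (Suc j)] (fold f [2..<Suc (Suc j)] y)
    = fold f [1..<Suc j] (fold f [1..<Suc (Suc j)] y)"
    using up_up[of j j y] assms by (simp del: upt_Suc)
  also have "fold f [1..<Suc (Suc j)] y = fold f [2..<Suc (Suc j)] y"
    using y by (simp add: upt_conv_Cons numeral_2_eq_2 del: upt_Suc)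
  finally show ?thesis
    using * by (simp del: upt_Suc)
qed

text \<open>On rooks: once the inserted zero has moved past the first letter, erasing that letter
  can equally be done before the insertion. Here \<open>zero_left\<close> removes the surplus
  \<open>1\<close>.\<close>

lemma down_up_kill:
  assumes "Suc j < N"
  shows "fold f (rev [0..<N] @ [1..<Suc (Suc j)] @ [0]) x = fold f ([0..<Suc j] @ rev [0..<N]) x"
proof -
  define y where "y = fold f (rev [2..<N]) x"
  have down: "fold f (rev [0..<N]) z = f 0 (f 1 (fold f (rev [2..<N]) z))" for z
    using assms by (simp add: rev_upt_0 upt_1_split del: upt_Suc One_nat_def)
  have "fold f (rev [0..<N] @ [1..<Suc (Suc j)] @ [0]) x
    = f 0 (fold f [2..<Suc (Suc j)] (f 1 (f 0 (f 1 y))))"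
    by (simp add: down upt_1_split y_def del: upt_Suc One_nat_def)
  also have "\<dots> = fold f [2..<Suc (Suc j)] (f 0 (f 1 (f 0 (f 1 y))))"
    using assms by (intro far_0_up) auto
  also have "\<dots> = fold f [2..<Suc (Suc j)] (f 0 (f 1 (f 0 y)))"
    using zero_left assms by simp
  also have "\<dots> = f 0 (fold f [2..<Suc (Suc j)] (f 1 (f 0 y)))"
    using assms by (intro far_0_up[symmetric]) auto
  also have "\<dots> = f 0 (fold f ([0..<Suc j] @ rev [1..<N]) x)"
    using up_down[OF assms, of x] by (simp add: upt_0_split y_def del: upt_Suc)
  finally show ?thesis
    using assms rev_upt_0 by (simp del: upt_Suc)
qed

lemma down_far:
  assumes "Suc k < p" "p \<le> N"
  shows "fold f (rev [p..<N] @ [k]) x = fold f (k # rev [p..<N]) x"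
  using assms far_fold[of k "rev [p..<N]"] by simp

lemma down_idem:
  assumes "p < N"
  shows "fold f (rev [p..<N] @ [p]) x = fold f (rev [p..<N]) x"
  using assms idem by (simp add: upt_conv_Cons)

lemma down_up_far:
  assumes "j < k" "Suc k < N"
  shows "fold f (rev [0..<N] @ [1..<Suc j] @ [Suc k]) x = fold f (k # rev [0..<N] @ [1..<Suc j]) x"
proof -
  have "f (Suc k) (fold f [1..<Suc j] y) = fold f [1..<Suc j] (f (Suc k) y)" for y
    using assms by (intro far_fold) auto
  moreover have "f (Suc k) (f 0 y) = f 0 (f (Suc k) y)" for y
    using assms by (intro far) auto
  ultimately show ?thesis
    using assms down_shift[of 1 k x] by (simp add: rev_upt_0 del: upt_Suc)
qed

text \<open>Going left, \<open>k\<close> is raised by the ascending word and lowered again by the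
  descending one.\<close>

lemma down_up_near:
  assumes "1 \<le> k" "k < j" "j < N"
  shows "fold f (rev [0..<N] @ [1..<Suc j] @ [k]) x = fold f (k # rev [0..<N] @ [1..<Suc j]) x"
proof -
  have "f (Suc k) (f 0 y) = f 0 (f (Suc k) y)" for y
    using assms by (intro far) auto
  then show ?thesis
    using assms down_shift[of 1 k x] up_shift[OF assms] by (simp add: rev_upt_0 del: upt_Suc)
qed

lemma down_up_idem:
  assumes "j < N"
  shows "fold f (rev [0..<N] @ [1..<Suc j] @ [j]) x = fold f (rev [0..<N] @ [1..<Suc j]) x"
  using assms idem by (cases j) (simp_all add: rev_upt_0)

end

section \<open>Words modulo the rook relations\<close>

abbreviation rook_eq :: "nat \<Rightarrow> nat list \<Rightarrow> nat list \<Rightarrow> bool" where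
  "rook_eq n u v \<equiv> (u, v) \<in> mcong (word_monoid n) (rook_rels n)"

lemma monoid_word_monoid: "monoid (word_monoid n)"
  by unfold_locales (auto simp: word_monoid_def)

lemma word_monoid_simps [simp]:
  "carrier (word_monoid n) = lists {..<n}"
  "u \<otimes>\<^bsub>word_monoid n\<^esub> v = u @ v"
  "\<one>\<^bsub>word_monoid n\<^esub> = []"
  by (simp_all add: word_monoid_def)

lemmas rook_eq_trans [trans] = mcong.trans[where M = "word_monoid n" and S = "rook_rels n" for n]

lemma rook_eq_words: "rook_eq n u v \<Longrightarrow> u \<in> lists {..<n} \<and> v \<in> lists {..<n}"
  using monoid.mcong_carrier[OF monoid_word_monoid] by fastforce

lemma rook_eq_refl: "u \<in> lists {..<n} \<Longrightarrow> rook_eq n u u"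
  by (simp add: mcong.refl)

lemma rook_eq_append: "rook_eq n u v \<Longrightarrow> rook_eq n u' v' \<Longrightarrow> rook_eq n (u @ u') (v @ v')"
  using mcong.mult[of u v "word_monoid n"] by fastforce

lemma rook_rels_words: "(u, v) \<in> rook_rels n \<Longrightarrow> u \<in> lists {..<n} \<and> v \<in> lists {..<n}"
  by (auto simp: rook_rels_def)

lemma rook_eq_Suc:
  assumes "rook_eq n u v"
  shows "rook_eq (Suc n) u v"
  using assms
proof induction
  case (base u v)
  then have "(u, v) \<in> rook_rels (Suc n)"
    by (auto simp: rook_rels_def)
  then show ?case
    using rook_rels_words[of u v "Suc n"] by (intro mcong.base) simp_all
next
  case (refl u)
  then show ?case
    by (intro rook_eq_refl) (auto simp: less_Suc_eq)
next
  case (mult u v u' v')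
  then show ?case
    using rook_eq_append by simp
qed (blast intro: mcong.sym mcong.trans)+

text \<open>On a class this is right multiplication by \<open>[k]\<close> when \<open>k < n\<close>.
  Being defined on arbitrary sets of words, it satisfies the identities of
  \<open>rook_functions\<close> at every argument.\<close>

definition right_mult :: "nat \<Rightarrow> nat \<Rightarrow> nat list set \<Rightarrow> nat list set" where
  "right_mult n k X = mcong (word_monoid n) (rook_rels n) `` ((\<lambda>u. u @ [k]) ` X)"

text \<open>Saturating at the intermediate steps adds nothing. The word has a first letter because
  \<open>fold\<close> over \<open>[]\<close> would return \<open>X\<close> unsaturated.\<close>

lemma fold_right_mult:
  assumes "w \<in> lists {..<n}" "k < n"
  shows "fold (right_mult n) (k # w) X
    = mcong (word_monoid n) (rook_rels n) `` ((\<lambda>u. u @ k # w) ` X)"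
  using assms(1)
proof (induction w rule: rev_induct)
  case Nil
  then show ?case
    by (simp add: right_mult_def)
next
  case (snoc l w)
  then have "fold (right_mult n) (k # w @ [l]) X
    = right_mult n l (mcong (word_monoid n) (rook_rels n) `` ((\<lambda>u. u @ k # w) ` X))"
    by simp
  also have "\<dots> = mcong (word_monoid n) (rook_rels n) `` ((\<lambda>u. u @ k # w @ [l]) ` X)"
    (is "?A = ?B")
  proof
    have l: "rook_eq n [l] [l]"
      using snoc.prems by (intro rook_eq_refl) simp
    show "?A \<subseteq> ?B"
    proof
      fix v assume "v \<in> ?A"
      then obtain u t where "u \<in> X" and 1: "rook_eq n (u @ k # w) t" and 2: "rook_eq n (t @ [l]) v"
        by (auto simp: right_mult_def)
      then have "rook_eq n (u @ k # w @ [l]) v"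
        using rook_eq_trans[OF rook_eq_append[OF 1 l] 2] by simp
      with \<open>u \<in> X\<close> show "v \<in> ?B" by blast
    qed
    show "?B \<subseteq> ?A"
    proof
      fix v assume "v \<in> ?B"
      then obtain u where u: "u \<in> X" and v: "rook_eq n (u @ k # w @ [l]) v"
        by auto
      then have "u @ k # w \<in> lists {..<n}"
        using rook_eq_words[OF v] by auto
      then have "rook_eq n (u @ k # w) (u @ k # w)"
        by (rule rook_eq_refl)
      with u have "(u @ k # w) \<in> mcong (word_monoid n) (rook_rels n) `` ((\<lambda>u. u @ k # w) ` X)"
        by blast
      with v show "v \<in> ?A"
        unfolding right_mult_def by force
    qed
  qed
  finally show ?case by simp
qed

lemma rook_functions_right_mult: "rook_functions (right_mult n) n"
proof -
  let ?f = "right_mult n"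
  have *: "fold ?f (k # u) X = fold ?f (l # v) X" if "(k # u, l # v) \<in> rook_rels n" for k l u v X
  proof -
    let ?E = "mcong (word_monoid n) (rook_rels n)"
    have w: "k # u \<in> lists {..<n}" "l # v \<in> lists {..<n}"
      using rook_rels_words[OF that] by auto
    have eq: "rook_eq n (k # u) (l # v)"
      using that w by (intro mcong.base) simp_all
    have "?E `` {x @ k # u} = ?E `` {x @ l # v}" for x
    proof (cases "x \<in> lists {..<n}")
      case True
      then have "rook_eq n (x @ k # u) (x @ l # v)"
        using eq by (intro rook_eq_append rook_eq_refl)
      then show ?thesis
        by (metis equiv_class_eq monoid.equiv_mcong monoid_word_monoid)
    next
      \<comment> \<open>The congruence relates only words over \<open>{..<n}\<close>, so both images
        are empty.\<close>
      case False
      then have "?E `` {x @ k # u} = {}" "?E `` {x @ l # v} = {}"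
        using rook_eq_words by fastforce+
      then show ?thesis by simp
    qed
    then have "?E `` ((\<lambda>x. x @ k # u) ` X) = ?E `` ((\<lambda>x. x @ l # v) ` X)"
      by (simp add: Image_eq_UN[of _ "_ ` _"])
    then show ?thesis
      using fold_right_mult w by simp
  qed
  show ?thesis
  proof
    show "?f i (?f i X) = ?f i X" if "i < n" for i X
      using *[of i "[i]" i "[]" X] that by (simp add: rook_rels_def)
    show "?f i (?f (Suc i) (?f i X)) = ?f (Suc i) (?f i (?f (Suc i) X))" if "1 \<le> i" "Suc i < n" for i X
      using *[of i "[Suc i, i]" "Suc i" "[i, Suc i]" X] that by (simp add: rook_rels_def)
    show "?f 0 (?f 1 (?f 0 (?f 1 X))) = ?f 0 (?f 1 (?f 0 X))" if "2 \<le> n" for X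
      using *[of 1 "[0, 1, 0]" 0 "[1, 0]" X] that by (simp add: rook_rels_def)
    show "?f 1 (?f 0 (?f 1 (?f 0 X))) = ?f 0 (?f 1 (?f 0 X))" if "2 \<le> n" for X
      using *[of 0 "[1, 0]" 0 "[1, 0, 1]" X] that by (simp add: rook_rels_def)
    show "?f i (?f j X) = ?f j (?f i X)" if "i + 2 \<le> j \<or> j + 2 \<le> i" "i < n" "j < n" for i j X
      using *[of j "[i]" i "[j]" X] that by (auto simp: rook_rels_def)
  qed
qed

text \<open>Evaluating the two folds at the class of \<open>[]\<close> gives the classes of
  \<open>u\<close> and \<open>v\<close>.\<close>

lemma rook_eqI:
  assumes "u \<in> lists {..<n}" "v \<in> lists {..<n}"
    and "\<And>X. fold (right_mult n) u X = fold (right_mult n) v X"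
  shows "rook_eq n u v"
proof -
  let ?E = "mcong (word_monoid n) (rook_rels n)"
  have "fold (right_mult n) w (?E `` {[]}) = ?E `` {w}" if "w \<in> lists {..<n}" for w
  proof (cases w)
    case (Cons k w')
    have "rook_eq n (x @ w) y \<longleftrightarrow> rook_eq n w y" if "rook_eq n [] x" for x y
      using rook_eq_append[OF that rook_eq_refl[OF \<open>w \<in> lists {..<n}\<close>]]
      by (metis append_Nil mcong.sym mcong.trans)
    moreover have "rook_eq n [] []"
      by (simp add: rook_eq_refl)
    ultimately have "?E `` ((\<lambda>u. u @ w) ` (?E `` {[]})) = ?E `` {w}"
      by blast
    then show ?thesis
      using fold_right_mult[of w' n k] that Cons by simp
  qed simp
  then have "?E `` {u} = ?E `` {v}"
    using assms by metis
  then show ?thesis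
    using assms by (simp add: monoid.mcong_class_eq_iff[OF monoid_word_monoid])
qed

section \<open>Compatibility of the action with the relations\<close>

lemma act_gen_commute:
  assumes "i + 2 \<le> j" "j < length r"
  shows "act_gen i (act_gen j r) = act_gen j (act_gen i r)"
proof -
  obtain a x y b where r: "r = a @ x # y # b" "j = Suc (length a)"
    using split_two[of j r] assms by (metis add_is_0 gr0I le_zero_eq numeral_eq_Suc nat.simps(3))
  then show ?thesis
    using assms act_gen_swap[of j "act_gen i a"] by (simp add: act_gen_swap act_gen_append)
qed

text \<open>Both sides of a braid relation sort three adjacent letters into decreasing order; every
  word in the relations between \<open>0\<close> and \<open>1\<close> replaces the first two letters
  by zeros.\<close>

lemma act_word_rook_rels:
  assumes "(u, v) \<in> rook_rels n" "length r = n"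
  shows "act_word r u = act_word r v"
proof -
  have idem: "act_gen i (act_gen i r) = act_gen i r" if i: "i < n" for i
  proof (cases "i = 0")
    case True
    then show ?thesis
      using assms(2) i by (cases r) auto
  next
    case False
    then obtain a x y b where "r = a @ x # y # b" "i = Suc (length a)"
      using split_two[of i r] i assms(2) by blast
    then show ?thesis
      by (simp add: act_gen_swap)
  qed
  have braid: "act_word r [i, Suc i, i] = act_word r [Suc i, i, Suc i]"
    if i: "1 \<le> i" "Suc i < n" for i
  proof -
    obtain a x y b where *: "r = a @ x # y # b" "i = Suc (length a)"
      using split_two[of i r] i assms(2) by (metis Suc_le_lessD Suc_lessD One_nat_def)
    then obtain z b' where "b = z # b'"
      using i assms(2) by (cases b) auto
    then show ?thesis
      using * act_gen_swap[of "Suc i" "a @ [_]"] act_gen_swap[of i a]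
      by (simp add: max_def min_def)
  qed
  have zero: "act_word r [1, 0, 1, 0] = act_word r [0, 1, 0] \<and> act_word r [0, 1, 0] = act_word r [0, 1, 0, 1]"
    if n: "2 \<le> n"
  proof -
    obtain x y b where "r = x # y # b"
      using n assms(2) by (metis One_nat_def Suc_1 Suc_le_length_iff)
    then show ?thesis
      using act_gen_swap[of 1 "[]"] by simp
  qed
  have far: "act_word r [i, j] = act_word r [j, i]"
    if "i < n" "j < n" "i + 2 \<le> j \<or> j + 2 \<le> i" for i j
    using that act_gen_commute[of i j r] act_gen_commute[of j i r] assms(2) by auto
  show ?thesis
    using assms(1) idem braid zero far by (auto simp: rook_rels_def)
qed

lemma act_word_cong:
  assumes "rook_eq n u v" "length r = n"
  shows "act_word r u = act_word r v"
  using assms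
proof (induction arbitrary: r)
  case (base u v)
  then show ?case
    using act_word_rook_rels by blast
next
  case (mult u v u' v')
  then show ?case
    by (metis act_word_append length_act_word word_monoid_simps(2))
qed simp_all

section \<open>Normal forms\<close>

lemma take_act_gen:
  assumes "j < k" "k < length r"
  shows "take j (act_gen k r) = take j r"
proof -
  have "0 < k"
    using assms(1) by simp
  then obtain a x y b where "r = a @ x # y # b" "k = Suc (length a)"
    using split_two[of k r] assms(2) by blast
  then show ?thesis
    using assms(1) by (simp add: act_gen_swap)
qed

lemma set_take_act_gen:
  assumes "0 < k" "k < j" "j \<le> length r"
  shows "set (take j (act_gen k r)) = set (take j r)"
proof -
  have "act_gen k r = act_gen k (take j r) @ drop j r"
    using act_gen_append[of k "take j r" "drop j r"] assms by simp
  then have "take j (act_gen k r) = act_gen k (take j r)"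
    using assms by simp
  then show ?thesis
    using assms by (simp add: set_act_gen_pos)
qed

text \<open>Every word for \<open>R0 (Suc n)\<close> is a word for \<open>R0 n\<close> followed by a coset representative:
  \<open>\<pi>\<^sub>n \<dots> \<pi>\<^sub>p\<close> puts the letter \<open>n + 1\<close> at position \<open>p\<close>, while
  \<open>\<pi>\<^sub>n \<dots> \<pi>\<^sub>0 \<pi>\<^sub>1 \<dots> \<pi>\<^sub>j\<close> replaces it by a zero at position \<open>j + 1\<close>, required to
  be the first zero.\<close>

definition normal_form :: "nat \<Rightarrow> nat list \<Rightarrow> nat list \<Rightarrow> bool" where
  "normal_form n u d \<longleftrightarrow> u \<in> lists {..<n} \<and>
     ((\<exists>p\<in>{1..Suc n}. d = rev [p..<Suc n])
    \<or> (\<exists>j\<le>n. d = rev [0..<Suc n] @ [1..<Suc j] \<and> 0 \<notin> set (take j (act_word (id_rook n) u))))"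

lemma normal_form_words:
  assumes "normal_form n u d"
  shows "u \<in> lists {..<n}" "u @ d \<in> lists {..<Suc n}"
  using assms by (auto simp: normal_form_def in_lists_conv_set less_Suc_eq simp del: upt_Suc)

lemma normal_form_down: "u \<in> lists {..<n} \<Longrightarrow> 1 \<le> p \<Longrightarrow> p \<le> Suc n \<Longrightarrow> normal_form n u (rev [p..<Suc n])"
  by (auto simp: normal_form_def)

lemma normal_form_down_up:
  "u \<in> lists {..<n} \<Longrightarrow> j \<le> n \<Longrightarrow> 0 \<notin> set (take j (act_word (id_rook n) u))
    \<Longrightarrow> normal_form n u (rev [0..<Suc n] @ [1..<Suc j])"
  by (auto simp: normal_form_def)

text \<open>The assumption is the induction hypothesis of \<open>rook_action_faithful\<close>,
  shared by all lemmas of the step from \<open>n\<close> to \<open>Suc n\<close>.\<close>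

locale faithful_rook_action =
  fixes n :: nat
  assumes faithful: "u \<in> lists {..<n} \<Longrightarrow> v \<in> lists {..<n}
    \<Longrightarrow> act_word (id_rook n) u = act_word (id_rook n) v \<Longrightarrow> rook_eq n u v"
begin

interpretation F: rook_functions "right_mult (Suc n)" "Suc n"
  by (rule rook_functions_right_mult)

text \<open>The new letter is absorbed, extends the coset representative \<open>d\<close>, or is
  traded for letters below \<open>n\<close> on the left of a representative.\<close>

lemma normal_form_step:
  assumes "normal_form n u d" "k \<le> n"
  shows "\<exists>u' d'. normal_form n u' d' \<and> rook_eq (Suc n) (u @ d @ [k]) (u' @ d')"
proof -
  let ?N = "Suc n" and ?f = "right_mult (Suc n)" and ?r = "act_word (id_rook n) u"
  have u: "u \<in> lists {..<n}" and ud: "u @ d @ [k] \<in> lists {..<?N}"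
    using normal_form_words[OF assms(1)] assms(2) by auto
  have *: ?thesis
    if "\<And>X. fold ?f (d @ [k]) X = fold ?f (v @ d') X" "normal_form n (u @ v) d'" for v d'
  proof -
    have "rook_eq ?N (u @ d @ [k]) (u @ v @ d')"
      using ud normal_form_words[OF that(2)] that(1) by (intro rook_eqI) simp_all
    then show ?thesis
      using that(2) by (metis append.assoc)
  qed
  from assms(1) consider
    (down) p where "1 \<le> p" "p \<le> ?N" "d = rev [p..<?N]"
  | (down_up) j where "j \<le> n" "d = rev [0..<?N] @ [1..<Suc j]" "0 \<notin> set (take j ?r)"
    by (auto simp: normal_form_def simp del: upt_Suc)
  then show ?thesis
  proof cases
    case down
    \<comment> \<open>In this order the letter is lowered and passes to the left, is absorbed, is
      appended, or commutes to the left. Appending \<open>0\<close> starts the second kind of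
      representative, with \<open>j = 0\<close>.\<close>
    consider "p < k" | "k = p" | "p = Suc k" | "Suc k < p" by linarith
    then show ?thesis
    proof cases
      case 1
      then obtain l where l: "k = Suc l" by (cases k) auto
      show ?thesis
      proof (rule *[of "[l]" d])
        show "fold ?f (d @ [k]) X = fold ?f ([l] @ d) X" for X
          using F.down_shift[of p l X] 1 l down assms(2) by (simp del: upt_Suc)
      qed (use u down l assms in \<open>auto intro!: normal_form_down simp del: upt_Suc\<close>)
    next
      case 2
      show ?thesis
      proof (rule *[of "[]" d])
        show "fold ?f (d @ [k]) X = fold ?f ([] @ d) X" for X
          using F.down_idem[of p X] 2 down assms(2) by (simp del: upt_Suc)
      qed (use assms in simp)
    next
      case 3
      have d: "d @ [k] = rev [k..<?N]"
        using down 3 assms(2) by (simp add: upt_conv_Cons del: upt_Suc)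
      show ?thesis
      proof (cases "k = 0")
        case True
        then show ?thesis
          using normal_form_down_up[OF u, of 0] d by (intro *[of "[]" "rev [0..<?N]"]) auto
      next
        case False
        then show ?thesis
          using normal_form_down[OF u, of k] d assms(2)
          by (intro *[of "[]" "rev [k..<?N]"]) auto
      qed
    next
      case 4
      show ?thesis
      proof (rule *[of "[k]" d])
        show "fold ?f (d @ [k]) X = fold ?f ([k] @ d) X" for X
          using F.down_far[of k p X] 4 down by (simp del: upt_Suc)
      qed (use u down 4 in \<open>auto intro!: normal_form_down simp del: upt_Suc\<close>)
    qed
  next
    case down_up
    consider "k = j" | "k = Suc j" | "Suc j < k" | "1 \<le> k" "k < j" | "k = 0" "0 < j" by linarith
    then show ?thesis
    proof cases
      case 1
      show ?thesis
      proof (rule *[of "[]" d])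
        show "fold ?f (d @ [k]) X = fold ?f ([] @ d) X" for X
          using F.down_up_idem[of j X] 1 down_up by (simp del: upt_Suc)
      qed (use assms in simp)
    next
      case 2
      have d: "d @ [k] = rev [0..<?N] @ [1..<Suc (Suc j)]"
        using down_up 2 by simp
      have split: "?r = take j ?r @ ?r ! j # drop (Suc j) ?r"
        using 2 assms(2) by (intro id_take_nth_drop) simp
      show ?thesis
      proof (cases "?r ! j = 0")
        case False
        then have "0 \<notin> set (take (Suc j) ?r)"
          using down_up(3) 2 assms(2) by (simp add: take_Suc_conv_app_nth)
        then show ?thesis
          using d u 2 assms(2)
          by (intro *[of "[]" "rev [0..<?N] @ [1..<Suc (Suc j)]"])
            (auto intro!: normal_form_down_up simp del: upt_Suc One_nat_def)
      next
        \<comment> \<open>Appending \<open>k\<close> would put the new zero behind an older one. By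
          faithfulness \<open>u\<close> can be replaced by a word ending in
          \<open>[0..<Suc j]\<close>, as \<open>down_up_cancel\<close> requires: \<open>r'\<close>
          has the zero at index \<open>j\<close> moved to the front, and this suffix carries it
          back.\<close>
        case True
        define r' where "r' = 0 # take j ?r @ drop (Suc j) ?r"
        have "mset r' = mset ?r"
          using True by (subst split) (simp add: r'_def)
        moreover have "?r \<in> rooks n"
          by (rule act_word_rooks[OF id_rook_in_rooks u])
        ultimately have "r' \<in> rooks n"
          using mset_eq_setD[of r' ?r] mset_eq_length[of r' ?r] distinct_filter_mset_cong[of r' ?r]
          by (simp add: rooks_def)
        then obtain u' where u': "u' \<in> lists {..<n}" "act_word (id_rook n) u' = r'"
          by (rule reach_rook)
        let ?v = "u' @ [0..<Suc j]"
        have v: "?v \<in> lists {..<n}"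
          using u' 2 assms(2) by (auto simp del: upt_Suc)
        have "act_word (id_rook n) ?v = act_word r' (0 # [1..<Suc j])"
          using u' by (simp add: upt_conv_Cons del: upt_Suc)
        also have "\<dots> = ?r"
          using act_word_up[of "take j ?r" "drop (Suc j) ?r"] split True 2 assms(2)
          by (simp add: r'_def min_def del: upt_Suc)
        finally have uv: "rook_eq ?N u ?v"
          using u v by (intro rook_eq_Suc faithful) simp_all
        have dw: "d @ [k] \<in> lists {..<?N}" "d \<in> lists {..<?N}"
          using ud normal_form_words[OF assms(1)] by auto
        have "rook_eq ?N (u @ d @ [k]) (?v @ d @ [k])"
          using uv dw by (intro rook_eq_append rook_eq_refl)
        also have "rook_eq ?N (?v @ d @ [k]) (?v @ d)"
        proof (rule rook_eqI)
          have "?v \<in> lists {..<?N}"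
            using rook_eq_words[OF uv] by blast
          then show "?v @ d @ [k] \<in> lists {..<?N}" "?v @ d \<in> lists {..<?N}"
            using dw by simp_all
          show "fold ?f (?v @ d @ [k]) X = fold ?f (?v @ d) X" for X
            using F.down_up_cancel[of j "fold ?f u' X"] 2 assms(2) unfolding d
            by (simp add: down_up(2) del: upt_Suc)
        qed
        also have "rook_eq ?N (?v @ d) (u @ d)"
          using uv dw by (intro rook_eq_append rook_eq_refl mcong.sym[of u])
        finally show ?thesis
          using assms(1) by blast
      qed
    next
      case 3
      then obtain l where l: "k = Suc l" by (cases k) auto
      show ?thesis
      proof (rule *[of "[l]" d])
        show "fold ?f (d @ [k]) X = fold ?f ([l] @ d) X" for X
          using F.down_up_far[of j l X] 3 l down_up assms(2) by (simp del: upt_Suc)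
        have "0 \<notin> set (take j (act_word (id_rook n) (u @ [l])))"
          using take_act_gen[of j l ?r] down_up 3 l assms(2) by simp
        then show "normal_form n (u @ [l]) d"
          using u l assms(2) down_up by (auto intro!: normal_form_down_up simp del: upt_Suc One_nat_def)
      qed
    next
      case 4
      show ?thesis
      proof (rule *[of "[k]" d])
        show "fold ?f (d @ [k]) X = fold ?f ([k] @ d) X" for X
          using F.down_up_near[of k j X] 4 down_up by (simp del: upt_Suc)
        have "0 \<notin> set (take j (act_word (id_rook n) (u @ [k])))"
          using set_take_act_gen[of k j ?r] down_up 4 by simp
        then show "normal_form n (u @ [k]) d"
          using u 4 down_up by (auto intro!: normal_form_down_up simp del: upt_Suc One_nat_def)
      qed
    next
      case 5
      then obtain i where i: "j = Suc i" by (cases j) auto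
      show ?thesis
      proof (rule *[of "[0..<Suc i]" "rev [0..<?N]"])
        show "fold ?f (d @ [k]) X = fold ?f ([0..<Suc i] @ rev [0..<?N]) X" for X
          using F.down_up_kill[of i X] 5 i down_up by (simp del: upt_Suc)
        have "u @ [0..<Suc i] \<in> lists {..<n}"
          using u i down_up(1) by (auto simp del: upt_Suc)
        then show "normal_form n (u @ [0..<Suc i]) (rev [0..<?N])"
          using normal_form_down_up[of "u @ [0..<Suc i]" n 0] by simp
      qed
    qed
  qed
qed

lemma normal_form_exists:
  assumes "w \<in> lists {..<Suc n}"
  shows "\<exists>u d. normal_form n u d \<and> rook_eq (Suc n) w (u @ d)"
  using assms
proof (induction w rule: rev_induct)
  case Nil
  have "normal_form n [] (rev [Suc n..<Suc n])"
    by (rule normal_form_down) auto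
  moreover have "rook_eq (Suc n) [] []"
    by (simp add: rook_eq_refl)
  ultimately show ?case
    by (intro exI[of _ "[]"]) simp
next
  case (snoc k w)
  then obtain u d where ud: "normal_form n u d" "rook_eq (Suc n) w (u @ d)"
    by auto
  obtain u' d' where "normal_form n u' d'" "rook_eq (Suc n) (u @ d @ [k]) (u' @ d')"
    using normal_form_step[OF ud(1), of k] snoc.prems by auto
  moreover have "rook_eq (Suc n) (w @ [k]) ((u @ d) @ [k])"
    using ud(2) snoc.prems by (intro rook_eq_append rook_eq_refl) simp_all
  then have "rook_eq (Suc n) (w @ [k]) (u @ d @ [k])"
    by simp
  ultimately show ?case
    using rook_eq_trans by blast
qed

text \<open>The word \<open>u\<close> leaves the last letter \<open>Suc n\<close> alone. As this
  letter is maximal, \<open>d\<close> either moves it into place or erases it and moves the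
  resulting zero.\<close>

lemma normal_form_act:
  assumes "normal_form n u d"
  shows "(\<exists>p\<in>{1..Suc n}. d = rev [p..<Suc n] \<and> act_word (id_rook (Suc n)) (u @ d)
        = take (p - 1) (act_word (id_rook n) u) @ Suc n # drop (p - 1) (act_word (id_rook n) u))
    \<or> (\<exists>j\<le>n. d = rev [0..<Suc n] @ [1..<Suc j] \<and> 0 \<notin> set (take j (act_word (id_rook n) u))
        \<and> act_word (id_rook (Suc n)) (u @ d)
        = take j (act_word (id_rook n) u) @ 0 # drop j (act_word (id_rook n) u))"
proof -
  let ?r = "act_word (id_rook n) u"
  have u: "u \<in> lists {..<n}"
    using normal_form_words[OF assms] by simp
  then have act: "act_word (id_rook (Suc n)) (u @ d) = act_word (?r @ [Suc n]) d"
    by (simp add: id_rook_Suc act_word_append_left)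
  have le: "\<forall>y\<in>set ?r. y \<le> Suc n"
    using set_act_word_id_rook[OF u] by fastforce
  have le': "\<forall>y\<in>set (drop i ?r). y \<le> Suc n" for i
    using le set_drop_subset by fastforce
  have down: "act_word (?r @ [Suc n]) (rev [p..<Suc n]) = take (p - 1) ?r @ Suc n # drop (p - 1) ?r"
    if p: "p \<in> {1..Suc n}" for p
  proof -
    obtain q where q: "p = Suc q" "q \<le> n"
      using p by (cases p) auto
    have len: "length (take q ?r) = q" "length (drop q ?r) = n - q"
      using q(2) by simp_all
    show ?thesis
      using act_word_down[of "drop q ?r" "Suc n" "take q ?r"] le' q unfolding len
      by (simp del: upt_Suc flip: append_assoc)
  qed
  have down_up: "act_word (?r @ [Suc n]) (rev [0..<Suc n] @ [1..<Suc j]) = take j ?r @ 0 # drop j ?r"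
    if j: "j \<le> n" for j
  proof -
    have len: "length (take j ?r) = j" "length (drop j ?r) = n - j"
      using j by simp_all
    show ?thesis
      using act_word_kill_up[of "take j ?r" "drop j ?r" "Suc n"] le j unfolding len
      by (simp del: upt_Suc flip: append_assoc)
  qed
  show ?thesis
    using assms down down_up unfolding normal_form_def act by blast
qed

text \<open>The insertion can be undone: \<open>Suc n\<close> occurs nowhere else, and an inserted
  zero is the first zero by the definition of \<open>normal_form\<close>.\<close>

lemma normal_form_unique:
  assumes "normal_form n u d" "normal_form n v e"
    and "act_word (id_rook (Suc n)) (u @ d) = act_word (id_rook (Suc n)) (v @ e)"
  shows "d = e \<and> act_word (id_rook n) u = act_word (id_rook n) v"
proof -
  let ?r = "act_word (id_rook n) u" and ?s = "act_word (id_rook n) v"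
  have uv: "u \<in> lists {..<n}" "v \<in> lists {..<n}"
    using normal_form_words assms by auto
  then have Suc_n: "Suc n \<notin> set ?r" "Suc n \<notin> set ?s"
    using set_act_word_id_rook by fastforce+
  \<comment> \<open>Stopping at the first \<open>x\<close>, \<open>takeWhile\<close> recovers the
    prefix, hence the position and the remaining letters.\<close>
  have eqD: "i = j \<and> ?r = ?s"
    if "take i ?r @ x # drop i ?r = take j ?s @ x # drop j ?s"
      "x \<notin> set (take i ?r)" "x \<notin> set (take j ?s)" "i \<le> n" "j \<le> n" for i j x
  proof -
    have "takeWhile (\<lambda>y. y \<noteq> x) (a @ x # b) = a" if "x \<notin> set a" for a b
      using that by (auto simp: takeWhile_tail takeWhile_eq_all_conv)
    from this[OF that(2), of "drop i ?r"] this[OF that(3), of "drop j ?s"]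
    have "take i ?r = take j ?s"
      by (simp only: that(1))
    moreover from this have "drop i ?r = drop j ?s"
      using that(1) by simp
    moreover from \<open>take i ?r = take j ?s\<close> have "i = j"
      using that(4,5) by (metis length_act_word length_id_rook length_take min.absorb2)
    ultimately show ?thesis
      by (metis append_take_drop_id)
  qed
  have Suc_n': "Suc n \<notin> set (take i ?r)" "Suc n \<notin> set (take i ?s)" for i
    using Suc_n by (meson in_set_takeD)+
  \<comment> \<open>The two kinds of representative never give the same rook, since only the first
    kind keeps the letter \<open>Suc n\<close>.\<close>
  have mixed: "a @ Suc n # b \<noteq> take j t @ 0 # drop j t" if "t = ?r \<or> t = ?s" for a b j t
  proof
    assume "a @ Suc n # b = take j t @ 0 # drop j t"
    then have "Suc n \<in> set (take j t @ 0 # drop j t)"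
      by (metis in_set_conv_decomp)
    then show False
      using that Suc_n by (auto dest: in_set_takeD in_set_dropD)
  qed
  from normal_form_act[OF assms(1)] show ?thesis
  proof (elim disjE bexE exE conjE)
    fix p assume p: "p \<in> {1..Suc n}" "d = rev [p..<Suc n]"
      "act_word (id_rook (Suc n)) (u @ d) = take (p - 1) ?r @ Suc n # drop (p - 1) ?r"
    from normal_form_act[OF assms(2)] show ?thesis
    proof (elim disjE bexE exE conjE)
      fix q assume q: "q \<in> {1..Suc n}" "e = rev [q..<Suc n]"
        "act_word (id_rook (Suc n)) (v @ e) = take (q - 1) ?s @ Suc n # drop (q - 1) ?s"
      then have "p - 1 = q - 1 \<and> ?r = ?s"
        using p(1,3) assms(3) Suc_n' by (intro eqD[of _ "Suc n"]) auto
      moreover from this have "p = q"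
        using p(1) q(1) by auto
      ultimately show ?thesis
        using p(2) q(2) by simp
    next
      fix j assume "act_word (id_rook (Suc n)) (v @ e) = take j ?s @ 0 # drop j ?s"
      then show ?thesis
        using p(3) assms(3) mixed by metis
    qed
  next
    fix i assume i: "i \<le> n" "d = rev [0..<Suc n] @ [1..<Suc i]" "0 \<notin> set (take i ?r)"
      "act_word (id_rook (Suc n)) (u @ d) = take i ?r @ 0 # drop i ?r"
    from normal_form_act[OF assms(2)] show ?thesis
    proof (elim disjE bexE exE conjE)
      fix j assume j: "j \<le> n" "e = rev [0..<Suc n] @ [1..<Suc j]" "0 \<notin> set (take j ?s)"
        "act_word (id_rook (Suc n)) (v @ e) = take j ?s @ 0 # drop j ?s"
      have "i = j \<and> ?r = ?s"
        using i j assms(3) by (intro eqD[of _ 0]) auto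
      then show ?thesis
        using i(2) j(2) by simp
    next
      fix q assume "act_word (id_rook (Suc n)) (v @ e) = take (q - 1) ?s @ Suc n # drop (q - 1) ?s"
      then show ?thesis
        using i(4) assms(3) mixed by metis
    qed
  qed
qed

lemma faithful_Suc:
  assumes "u \<in> lists {..<Suc n}" "v \<in> lists {..<Suc n}"
    and "act_word (id_rook (Suc n)) u = act_word (id_rook (Suc n)) v"
  shows "rook_eq (Suc n) u v"
proof -
  obtain u' d where u: "normal_form n u' d" "rook_eq (Suc n) u (u' @ d)"
    using normal_form_exists[OF assms(1)] by blast
  obtain v' e where v: "normal_form n v' e" "rook_eq (Suc n) v (v' @ e)"
    using normal_form_exists[OF assms(2)] by blast
  have "act_word (id_rook (Suc n)) (u' @ d) = act_word (id_rook (Suc n)) (v' @ e)"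
    using act_word_cong[OF u(2)] act_word_cong[OF v(2)] assms(3) by simp
  then have "d = e" "act_word (id_rook n) u' = act_word (id_rook n) v'"
    using normal_form_unique[OF u(1) v(1)] by auto
  moreover from this have "rook_eq (Suc n) u' v'"
    using normal_form_words u(1) v(1) by (intro rook_eq_Suc faithful) auto
  moreover have "d \<in> lists {..<Suc n}"
    using normal_form_words(2)[OF u(1)] by simp
  ultimately have "rook_eq (Suc n) (u' @ d) (v' @ e)"
    using rook_eq_append rook_eq_refl by metis
  then show ?thesis
    using u(2) v(2) by (meson mcong.sym rook_eq_trans)
qed

end

lemma rook_action_faithful:
  assumes "u \<in> lists {..<n}" "v \<in> lists {..<n}"
    and "act_word (id_rook n) u = act_word (id_rook n) v"
  shows "rook_eq n u v"
proof -
  have "faithful_rook_action n"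
  proof (induction n)
    case 0
    show ?case
      by standard (simp add: rook_eq_refl)
  next
    case (Suc n)
    then show ?case
      by unfold_locales (rule faithful_rook_action.faithful_Suc)
  qed
  then show ?thesis
    using assms by (rule faithful_rook_action.faithful)
qed

section \<open>The 0-rook monoid\<close>

lemma monoid_R0: "monoid (R0 n)"
  unfolding R0_def by (rule monoid.monoid_quot_monoid[OF monoid_word_monoid])

lemma carrier_R0: "carrier (R0 n) = R0_class n ` lists {..<n}"
  using monoid.carrier_quot_monoid[OF monoid_word_monoid]
  by (simp add: R0_def R0_class_def)

lemma R0_class_in_carrier: "w \<in> lists {..<n} \<Longrightarrow> R0_class n w \<in> carrier (R0 n)"
  by (simp add: carrier_R0)

lemma R0_class_mult:
  assumes "u \<in> lists {..<n}" "v \<in> lists {..<n}"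
  shows "R0_class n u \<otimes>\<^bsub>R0 n\<^esub> R0_class n v = R0_class n (u @ v)"
  using monoid.quot_monoid_mult[OF monoid_word_monoid, of u n v "rook_rels n"] assms
  by (simp add: R0_def R0_class_def)

lemma R0_class_eqI:
  assumes "rook_eq n u v"
  shows "R0_class n u = R0_class n v"
  unfolding R0_class_def using assms
  by (rule equiv_class_eq[OF monoid.equiv_mcong[OF monoid_word_monoid]])

lemma act_R0_class:
  assumes "w \<in> lists {..<n}" "length r = n"
  shows "act r (R0_class n w) = act_word r w"
proof -
  have "w \<in> R0_class n w"
    using assms by (simp add: R0_class_def rook_eq_refl)
  moreover have "act_word r v = act_word r w" if "v \<in> R0_class n w" for v
    using that act_word_cong[of w v n r] assms(2) by (simp add: R0_class_def)
  ultimately have "act_word r ` R0_class n w = {act_word r w}"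
    by blast
  then show ?thesis
    by (simp add: act_def)
qed

lemma act_mult:
  assumes "x \<in> carrier (R0 n)" "y \<in> carrier (R0 n)" "length r = n"
  shows "act r (x \<otimes>\<^bsub>R0 n\<^esub> y) = act (act r x) y"
proof -
  obtain u v where uv: "u \<in> lists {..<n}" "v \<in> lists {..<n}"
    and "x = R0_class n u" "y = R0_class n v"
    using assms(1,2) by (auto simp: carrier_R0)
  moreover have "u @ v \<in> lists {..<n}"
    using uv by simp
  ultimately show ?thesis
    using assms(3) act_R0_class[of "u @ v"] act_R0_class[of u] act_R0_class[of v]
    by (simp add: R0_class_mult del: append_in_lists_conv)
qed

lemma act_rooks:
  assumes "x \<in> carrier (R0 n)" "r \<in> rooks n"
  shows "act r x \<in> rooks n"
proof -
  obtain w where w: "w \<in> lists {..<n}" "x = R0_class n w"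
    using assms(1) by (auto simp: carrier_R0)
  moreover have "length r = n"
    using assms by (simp add: rooks_def)
  ultimately show ?thesis
    using act_word_rooks[OF assms(2) w(1)] act_R0_class[OF w(1)] by simp
qed

text \<open>Faithfulness makes the description in \<open>pi_rook\<close> unique, so it can be
  evaluated at any word leading to the rook.\<close>

lemma pi_rook_act_word:
  assumes "w \<in> lists {..<n}"
  shows "pi_rook n (act_word (id_rook n) w) = R0_class n w"
  unfolding pi_rook_def
proof (rule the_equality)
  show "R0_class n w \<in> carrier (R0 n) \<and> act (id_rook n) (R0_class n w) = act_word (id_rook n) w"
    using assms by (simp add: R0_class_in_carrier act_R0_class)
next
  fix x assume x: "x \<in> carrier (R0 n) \<and> act (id_rook n) x = act_word (id_rook n) w"
  then obtain v where v: "v \<in> lists {..<n}" "x = R0_class n v"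
    by (auto simp: carrier_R0)
  then have "act_word (id_rook n) v = act_word (id_rook n) w"
    using x by (simp add: act_R0_class)
  then show "x = R0_class n w"
    using v assms by (simp add: R0_class_eqI rook_action_faithful)
qed

section \<open>Stellar truncation\<close>

definition truncate_below :: "nat \<Rightarrow> nat \<Rightarrow> nat" where
  "truncate_below m x = (if x < m then 0 else x)"

text \<open>Equal to \<open>0\<close> if no letter is missing, so that \<open>St\<close> is a truncation in all cases.\<close>

definition cutoff :: "nat \<Rightarrow> nat list \<Rightarrow> nat" where
  "cutoff n r = Max (insert 0 {i \<in> {1..n}. i \<notin> set r})"

lemma mono_truncate_below: "mono (truncate_below m)"
  by (auto simp: mono_def truncate_below_def)

lemma truncate_below_0 [simp]: "truncate_below m 0 = 0"
  by (simp add: truncate_below_def)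

lemma truncate_below_zero [simp]: "truncate_below 0 = id"
  by (auto simp: truncate_below_def)

lemma cutoff_missing: "cutoff n r = 0 \<or> cutoff n r \<in> {1..n} \<and> cutoff n r \<notin> set r"
proof -
  have "cutoff n r \<in> insert 0 {i \<in> {1..n}. i \<notin> set r}"
    unfolding cutoff_def by (rule Max_in) auto
  then show ?thesis by auto
qed

lemma le_cutoff: "i \<le> n \<Longrightarrow> i \<notin> set r \<Longrightarrow> i \<le> cutoff n r"
  unfolding cutoff_def by (cases "i = 0") (auto intro: Max_ge)

lemma cutoff_eqI:
  assumes "c = 0 \<or> c \<le> n \<and> c \<notin> set r" "\<And>i. c < i \<Longrightarrow> i \<le> n \<Longrightarrow> i \<in> set r"
  shows "cutoff n r = c"
proof (rule antisym)
  show "c \<le> cutoff n r"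
    using assms(1) le_cutoff by auto
  show "cutoff n r \<le> c"
    using cutoff_missing[of n r] assms(2)[of "cutoff n r"] by force
qed

lemma cutoff_mono:
  assumes "set t \<subseteq> insert 0 (set r)"
  shows "cutoff n r \<le> cutoff n t"
  unfolding cutoff_def using assms by (intro Max_mono) auto

lemma St_eq: "St n r = map (truncate_below (cutoff n r)) r"
proof (cases "{1..n} \<subseteq> set r")
  case True
  then have "cutoff n r = 0"
    by (intro cutoff_eqI) auto
  then show ?thesis
    using True by (simp add: St_def)
next
  case False
  then have "cutoff n r = max_missing n r"
    unfolding cutoff_def max_missing_def by (subst Max_insert) auto
  then show ?thesis
    using False by (simp add: St_def truncate_below_def)
qed

text \<open>The letters above the cutoff survive and only zeros are created, so the cutoff is
  unchanged and the second truncation subsumes the first.\<close>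

lemma St_truncate_below:
  assumes "m \<le> cutoff n r"
  shows "St n (map (truncate_below m) r) = St n r"
proof -
  have "cutoff n (map (truncate_below m) r) = cutoff n r"
  proof (rule cutoff_eqI)
    show "cutoff n r = 0 \<or> cutoff n r \<le> n \<and> cutoff n r \<notin> set (map (truncate_below m) r)"
      using cutoff_missing[of n r] by (auto simp: truncate_below_def)
    show "i \<in> set (map (truncate_below m) r)" if "cutoff n r < i" "i \<le> n" for i
    proof -
      have "i \<in> set r"
        using that le_cutoff[of i n r] by fastforce
      moreover have "truncate_below m i = i"
        using that assms by (simp add: truncate_below_def)
      ultimately show ?thesis by force
    qed
  qed
  then show ?thesis
    using assms by (auto simp: St_eq truncate_below_def)
qed

text \<open>The action introduces no letter except \<open>0\<close>, so the cutoff can only grow and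
  the final truncation subsumes the earlier one.\<close>

lemma St_act_word:
  assumes "w \<in> lists {..<n}" "length r = n"
  shows "St n (act_word (St n r) w) = St n (act_word r w)"
proof -
  have "act_word (St n r) w = map (truncate_below (cutoff n r)) (act_word r w)"
    using assms by (simp add: St_eq map_act_word mono_truncate_below)
  moreover have "cutoff n r \<le> cutoff n (act_word r w)"
    using assms by (intro cutoff_mono set_act_word) simp
  ultimately show ?thesis
    by (simp add: St_truncate_below)
qed

text \<open>One pass of bubble sort from the right: the first generator puts the larger of the last
  two letters on the left, and the induction continues without the smaller one.\<close>

lemma act_word_max:
  assumes "length a = Suc i"
  shows "\<exists>m c. act_word a (rev [1..<Suc i]) = m # c \<and> mset a = mset (m # c) \<and> (\<forall>x\<in>set c. x \<le> m)"
  using assms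
proof (induction i arbitrary: a)
  case 0
  then obtain x where "a = [x]"
    by (auto simp: length_Suc_conv)
  then show ?case by auto
next
  case (Suc i)
  have "0 < Suc i" "Suc i < length a"
    using Suc.prems by simp_all
  then obtain b x y b' where "a = b @ x # y # b'" "Suc i = Suc (length b)"
    using split_two by blast
  with Suc.prems have a: "a = b @ x # y # []" "length b = i"
    by simp_all
  obtain m c where IH: "act_word (b @ [max x y]) (rev [1..<Suc i]) = m # c"
      "mset (b @ [max x y]) = mset (m # c)" "\<forall>z\<in>set c. z \<le> m"
    using Suc.IH[of "b @ [max x y]"] a by auto
  have "act_word a (rev [1..<Suc (Suc i)]) = act_word ((b @ [max x y]) @ [min x y]) (rev [1..<Suc i])"
    using a act_gen_swap[of "Suc i" b x y "[]"] by simp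
  also have "\<dots> = m # c @ [min x y]"
    using IH(1) a by (subst act_word_append_left) (auto simp del: upt_Suc)
  finally have "act_word a (rev [1..<Suc (Suc i)]) = m # c @ [min x y]" .
  moreover have "mset a = add_mset (min x y) (mset (b @ [max x y]))"
    using a by (auto simp: min_def max_def)
  then have "mset a = mset (m # c @ [min x y])"
    using IH(2) by simp
  moreover have "max x y \<in> set (m # c)"
    using IH(2) by (metis mset_eq_setD in_set_conv_decomp)
  then have "min x y \<le> m"
    using IH(3) by (auto simp: max_def min_def split: if_splits)
  ultimately show ?case
    using IH(3) by (intro exI[of _ m] exI[of _ "c @ [min x y]"]) auto
qed

lemma St_stell_rels:
  assumes "r \<in> rooks n" "i < n"
  shows "St n (act_word r (rev [0..<Suc i] @ [i])) = St n (act_word r (rev [0..<Suc i]))"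
proof -
  have len: "length r = n"
    using assms by (simp add: rooks_def)
  define a b where "a = take (Suc i) r" and "b = drop (Suc i) r"
  have ab: "r = a @ b" "length a = Suc i"
    using assms(2) len by (simp_all add: a_def b_def)
  obtain m c where m: "act_word a (rev [1..<Suc i]) = m # c" "mset a = mset (m # c)"
      "\<forall>x\<in>set c. x \<le> m"
    using act_word_max[OF ab(2)] by blast
  define t where "t = 0 # c @ b"
  have t: "act_word r (rev [0..<Suc i]) = t"
  proof -
    have "act_word r (rev [1..<Suc i]) = m # c @ b"
      unfolding ab(1) using m(1) ab(2) by (subst act_word_append_left) (auto simp del: upt_Suc)
    then show ?thesis
      by (simp add: rev_upt_0 t_def del: upt_Suc)
  qed
  have lc: "length c = i"
    using m(2) ab(2) by (metis Suc_inject length_Cons mset_eq_length)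
  let ?g = "truncate_below (cutoff n t)"
  have mset_r: "mset r = mset (m # c @ b)"
    using m(2) ab(1) by simp
  then have "m \<in> set r"
    by (metis list.set_intros(1) mset_eq_setD)
  then have "m \<le> n"
    using assms(1) by (auto simp: rooks_def)
  moreover have "distinct (filter (\<lambda>x. x \<noteq> 0) (m # c @ b))"
    using assms(1) distinct_filter_mset_cong[OF mset_r] by (auto simp: rooks_def)
  \<comment> \<open>A nonzero \<open>m\<close> occurs only once in \<open>r\<close>, and this
    occurrence has been erased.\<close>
  then have "m = 0 \<or> m \<notin> set t"
    by (auto simp: t_def split: if_splits)
  ultimately have "m \<le> cutoff n t"
    using le_cutoff by auto
  \<comment> \<open>A surviving nonzero \<open>x\<close> would satisfy
    \<open>cutoff n t \<le> x \<le> m \<le> cutoff n t\<close> and so equal the cutoff, which is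
    missing from \<open>t\<close>.\<close>
  have zero: "?g x = 0" if "x \<in> set (0 # c)" for x
  proof (rule ccontr)
    assume "?g x \<noteq> 0"
    then have "cutoff n t \<le> x" "x \<noteq> 0"
      by (auto simp: truncate_below_def split: if_splits)
    moreover have "x \<le> m"
      using that m(3) by auto
    ultimately have "cutoff n t = x"
      using \<open>m \<le> cutoff n t\<close> by simp
    then show False
      using cutoff_missing[of n t] that \<open>x \<noteq> 0\<close> by (auto simp: t_def)
  qed
  show ?thesis
  proof (cases "i = 0")
    \<comment> \<open>Unlike the other generators, \<open>0\<close> does not permute letters, but
      \<open>t\<close> already begins with \<open>0\<close>.\<close>
    case True
    then show ?thesis
      using t by (simp add: t_def)
  next
    case False
    have i: "i < length t"
      using lc by (simp add: t_def)
    \<comment> \<open>A swap keeps the set of letters, so both sides are truncated at the same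
      cutoff.\<close>
    have "cutoff n (act_gen i t) = cutoff n t"
      using False i by (simp add: cutoff_def set_act_gen_pos)
    then have "St n (act_gen i t) = act_gen i (map ?g t)"
      using i by (simp add: St_eq map_act_gen mono_truncate_below)
    also have "map ?g t ! k = 0" if "k \<le> i" for k
    proof -
      have "t ! k \<in> set (0 # c)"
        using that lc nth_mem[of k "0 # c"] nth_append[of "0 # c" b k] by (simp add: t_def)
      then show ?thesis
        using zero that i by simp
    qed
    then have "act_gen i (map ?g t) = map ?g t"
      by (simp add: act_gen_def False)
    finally show ?thesis
      using t by (simp add: St_eq)
  qed
qed

section \<open>The stellar congruence\<close>

abbreviation stell_cong :: "nat \<Rightarrow> (nat list set \<times> nat list set) set" where
  "stell_cong n \<equiv> mcong (R0 n) (stell_rels n)"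

text \<open>Quantified over all rooks because the product case needs the hypothesis on the second
  factors at \<open>act r x\<close>.\<close>

lemma St_act_stell_cong:
  assumes "(x, y) \<in> stell_cong n" "r \<in> rooks n"
  shows "St n (act r x) = St n (act r y)"
  using assms
proof (induction arbitrary: r)
  case (base x y)
  then obtain i where i: "i < n"
    and xy: "x = R0_class n (rev [0..<Suc i] @ [i])" "y = R0_class n (rev [0..<Suc i])"
    by (auto simp: stell_rels_def simp del: upt_Suc)
  have "rev [0..<Suc i] \<in> lists {..<n}"
    using i by (auto simp del: upt_Suc)
  moreover have "length r = n"
    using base.prems by (simp add: rooks_def)
  ultimately show ?case
    using St_stell_rels[OF base.prems i] i xy by (simp add: act_R0_class del: upt_Suc)
next
  case (mult x y u v)
  have carr: "x \<in> carrier (R0 n)" "y \<in> carrier (R0 n)" "u \<in> carrier (R0 n)" "v \<in> carrier (R0 n)"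
    using mult.hyps monoid.mcong_carrier[OF monoid_R0] by blast+
  have len: "length s = n" if "s \<in> rooks n" for s
    using that by (simp add: rooks_def)
  have St: "St n (act s v) = St n (act (St n s) v)" if "length s = n" for s
  proof -
    obtain w where "w \<in> lists {..<n}" "v = R0_class n w"
      using carr(4) by (auto simp: carrier_R0)
    then show ?thesis
      using that St_act_word[of w n s] by (simp add: act_R0_class St_eq)
  qed
  have "St n (act r (x \<otimes>\<^bsub>R0 n\<^esub> u)) = St n (act (act r x) u)"
    using carr len mult.prems by (simp add: act_mult)
  also have "\<dots> = St n (act (act r x) v)"
    using act_rooks carr mult.prems by (intro mult.IH)
  \<comment> \<open>Up to a final \<open>St\<close>, the effect of \<open>v\<close> depends only on
    the truncation of its argument, and \<open>act r x\<close> and \<open>act r y\<close> have the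
    same truncation.\<close>
  also have "\<dots> = St n (act (act r y) v)"
    using St[of "act r x"] St[of "act r y"] mult.IH(1)[OF mult.prems] act_rooks carr mult.prems len
    by metis
  also have "\<dots> = St n (act r (y \<otimes>\<^bsub>R0 n\<^esub> v))"
    using carr len mult.prems by (simp add: act_mult)
  finally show ?case .
qed simp_all

lemma stell_cong_append:
  assumes "(R0_class n u, R0_class n v) \<in> stell_cong n"
    and "u \<in> lists {..<n}" "v \<in> lists {..<n}" "a \<in> lists {..<n}" "b \<in> lists {..<n}"
  shows "(R0_class n (a @ u @ b), R0_class n (a @ v @ b)) \<in> stell_cong n"
proof -
  have refl: "(R0_class n w, R0_class n w) \<in> stell_cong n" if "w \<in> lists {..<n}" for w
    using that by (intro mcong.refl R0_class_in_carrier)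
  have "(R0_class n a \<otimes>\<^bsub>R0 n\<^esub> (R0_class n u \<otimes>\<^bsub>R0 n\<^esub> R0_class n b),
    R0_class n a \<otimes>\<^bsub>R0 n\<^esub> (R0_class n v \<otimes>\<^bsub>R0 n\<^esub> R0_class n b)) \<in> stell_cong n"
    using assms refl by (intro mcong.mult)
  then show ?thesis
    using assms by (simp add: R0_class_mult)
qed

text \<open>The word \<open>rev [0..<Suc i]\<close> ends in \<open>rev [0..<Suc j]\<close>, which
  absorbs \<open>j\<close> by the relation of index \<open>j\<close>.\<close>

lemma stell_cong_absorb_letter:
  assumes "j \<le> i" "i < n"
  shows "(R0_class n (rev [0..<Suc i] @ [j]), R0_class n (rev [0..<Suc i])) \<in> stell_cong n"
proof -
  have rev_split: "rev [0..<Suc i] = rev [Suc j..<Suc i] @ rev [0..<Suc j]"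
    using assms upt_add_eq_append[of 0 "Suc j" "i - j"] by (simp del: upt_Suc)
  have words: "rev [0..<Suc j] \<in> lists {..<n}" "rev [0..<Suc j] @ [j] \<in> lists {..<n}"
    "rev [Suc j..<Suc i] \<in> lists {..<n}"
    using assms by (auto simp del: upt_Suc)
  have "(R0_class n (rev [0..<Suc j] @ [j]), R0_class n (rev [0..<Suc j])) \<in> stell_rels n"
    using assms by (auto simp: stell_rels_def simp del: upt_Suc)
  then have "(R0_class n (rev [0..<Suc j] @ [j]), R0_class n (rev [0..<Suc j])) \<in> stell_cong n"
    using words by (intro mcong.base R0_class_in_carrier)
  from stell_cong_append[OF this words(2,1,3), of "[]"] show ?thesis
    by (simp add: rev_split del: upt_Suc)
qed

lemma stell_cong_absorb:
  assumes "u \<in> lists {..<Suc i}" "i < n"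
  shows "(R0_class n (rev [0..<Suc i] @ u), R0_class n (rev [0..<Suc i])) \<in> stell_cong n"
  using assms(1)
proof (induction u)
  case Nil
  have "rev [0..<Suc i] \<in> lists {..<n}"
    using assms(2) by (auto simp del: upt_Suc)
  then show ?case
    by (auto intro!: mcong.refl R0_class_in_carrier simp del: upt_Suc)
next
  case (Cons j u)
  have words: "rev [0..<Suc i] @ [j] \<in> lists {..<n}" "rev [0..<Suc i] \<in> lists {..<n}" "u \<in> lists {..<n}"
    using assms(2) Cons.hyps by (auto simp: in_lists_conv_set simp del: upt_Suc)
  have "(R0_class n (rev [0..<Suc i] @ [j]), R0_class n (rev [0..<Suc i])) \<in> stell_cong n"
    using Cons.hyps assms(2) by (intro stell_cong_absorb_letter) auto
  from stell_cong_append[OF this words(1,2) _ words(3), of "[]"]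
  have "(R0_class n (rev [0..<Suc i] @ j # u), R0_class n (rev [0..<Suc i] @ u)) \<in> stell_cong n"
    by (simp del: upt_Suc)
  moreover have "(R0_class n (rev [0..<Suc i] @ u), R0_class n (rev [0..<Suc i])) \<in> stell_cong n"
    using Cons by simp
  ultimately show ?case
    by (rule mcong.trans)
qed

text \<open>If \<open>m\<close> is the largest letter missing from \<open>r\<close>, then \<open>\<pi>\<^sub>r = \<pi>\<^bsub>m-1\<^esub> \<dots> \<pi>\<^sub>0 v\<close> for some
  word \<open>v\<close>, and inserting before \<open>v\<close> a word killing the first \<open>m\<close> letters turns this into
  \<open>\<pi>\<^bsub>St(r)\<^esub>\<close>.\<close>

lemma stell_cong_St:
  assumes w: "w \<in> lists {..<n}"
  shows "\<exists>w'\<in>lists {..<n}. act_word (id_rook n) w' = St n (act_word (id_rook n) w)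
    \<and> (R0_class n w, R0_class n w') \<in> stell_cong n"
proof -
  define r where "r = act_word (id_rook n) w"
  have r: "r \<in> rooks n"
    unfolding r_def by (rule act_word_rooks[OF id_rook_in_rooks w])
  show ?thesis
  proof (cases "cutoff n r")
    case 0
    then have "St n r = r"
      by (simp add: St_eq)
    moreover have "(R0_class n w, R0_class n w) \<in> stell_cong n"
      using w by (intro mcong.refl R0_class_in_carrier)
    ultimately show ?thesis
      using w by (auto simp: r_def)
  next
    case (Suc i)
    let ?z = "rev [0..<Suc i]" and ?top = "[Suc (Suc i)..<Suc n]"
    have i: "i < n" "Suc i \<notin> set r"
      using cutoff_missing[of n r] Suc by auto
    have z: "?z \<in> lists {..<n}"
      using i by (auto simp del: upt_Suc)
    have id_rook: "id_rook n = ([1..<Suc i] @ [Suc i]) @ ?top"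
      using i upt_add_eq_append[of 1 "Suc (Suc i)" "n - Suc i"] by (simp add: id_rook_def del: upt_Suc) simp
    \<comment> \<open>The word \<open>?z\<close> carries the letter \<open>Suc i\<close> to the
      front and turns it into \<open>0\<close>, leaving \<open>0, 1, ..., i\<close> at the
      start.\<close>
    have act_z: "act_word (id_rook n) ?z = [0..<Suc i] @ ?top"
    proof -
      have "act_word (id_rook n) ?z = act_word ([1..<Suc i] @ [Suc i]) ?z @ ?top"
        unfolding id_rook by (intro act_word_append_left) (auto simp del: upt_Suc)
      also have "act_word ([1..<Suc i] @ [Suc i]) ?z = [0..<Suc i]"
        using act_word_kill[of "[1..<Suc i]" "Suc i"] by (simp add: upt_conv_Cons del: upt_Suc)
      finally show ?thesis .
    qed
    \<comment> \<open>This list is sorted, and the only letter it lacks, \<open>Suc i\<close>, is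
      missing from \<open>r\<close> as well.\<close>
    have "\<exists>v\<in>lists {..<length ([0..<Suc i] @ ?top)}. act_word ([0..<Suc i] @ ?top) v = r"
    proof (rule reach)
      show "sorted ([0..<Suc i] @ ?top)"
        by (auto simp: sorted_append simp del: upt_Suc)
      show "length r = length ([0..<Suc i] @ ?top)"
        using r i by (simp add: rooks_def del: upt_Suc)
      show "distinct (filter (\<lambda>x. x \<noteq> 0) r)"
        using r by (simp add: rooks_def)
      show "set r \<subseteq> insert 0 (set ([0..<Suc i] @ ?top))"
      proof
        fix x assume "x \<in> set r"
        then have "x \<le> n" "x \<noteq> Suc i"
          using r i by (auto simp: rooks_def)
        then show "x \<in> insert 0 (set ([0..<Suc i] @ ?top))"
          by (auto simp del: upt_Suc)
      qed
    qed
    then obtain v where v: "v \<in> lists {..<n}" "act_word ([0..<Suc i] @ ?top) v = r"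
      using i by (auto simp del: upt_Suc)
    \<comment> \<open>The zero list is a second target for \<open>reach\<close>; the resulting
      \<open>p\<close> uses only letters up to \<open>i\<close>, so \<open>?z\<close> absorbs
      it.\<close>
    have "\<exists>p\<in>lists {..<length [0..<Suc i]}. act_word [0..<Suc i] p = replicate (Suc i) 0"
      by (rule reach) (auto simp del: upt_Suc)
    then obtain p where p: "p \<in> lists {..<Suc i}" "act_word [0..<Suc i] p = replicate (Suc i) 0"
      by (auto simp del: upt_Suc)
    have p': "p \<in> lists {..<n}"
      using p(1) i by (auto simp: in_lists_conv_set)
    have "act_word (id_rook n) (?z @ p @ v) = act_word (act_word ([0..<Suc i] @ ?top) p) v"
      using act_z by (simp del: upt_Suc)
    also have "act_word ([0..<Suc i] @ ?top) p = replicate (Suc i) 0 @ ?top"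
      using p by (subst act_word_append_left) (simp_all del: upt_Suc)
    \<comment> \<open>Erasing the prefix is truncation at \<open>Suc i\<close>, since the letters of
      \<open>?top\<close> are larger; truncation commutes with \<open>v\<close>.\<close>
    also have "\<dots> = map (truncate_below (Suc i)) ([0..<Suc i] @ ?top)"
      by (simp add: list_eq_iff_nth_eq nth_append truncate_below_def del: upt_Suc replicate_Suc)
    also have "act_word \<dots> v = map (truncate_below (Suc i)) (act_word ([0..<Suc i] @ ?top) v)"
      using v(1) i by (intro map_act_word[symmetric] mono_truncate_below) (simp_all del: upt_Suc)
    also have "\<dots> = St n r"
      using v(2) Suc by (simp add: St_eq)
    finally have 1: "act_word (id_rook n) (?z @ p @ v) = St n r" .
    have "rook_eq n w (?z @ v)"
      using w z v act_z by (intro rook_action_faithful) (simp_all add: r_def del: upt_Suc)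
    then have "R0_class n w = R0_class n (?z @ v)"
      by (rule R0_class_eqI)
    moreover have "(R0_class n (?z @ p), R0_class n ?z) \<in> stell_cong n"
      using p(1) i(1) by (rule stell_cong_absorb)
    then have "(R0_class n ([] @ (?z @ p) @ v), R0_class n ([] @ ?z @ v)) \<in> stell_cong n"
      using z p' v(1) by (intro stell_cong_append) (simp_all del: upt_Suc)
    ultimately have "(R0_class n w, R0_class n (?z @ p @ v)) \<in> stell_cong n"
      by (simp add: mcong.sym del: upt_Suc)
    then show ?thesis
      using 1 z p' v(1) by (intro bexI[of _ "?z @ p @ v"]) (simp_all add: r_def del: upt_Suc)
  qed
qed

section \<open>The kernel and the image of \<open>St0\<close>\<close>

lemma St0_stell_cong:
  assumes "x \<in> carrier (R0 n)"
  shows "(x, St0 n x) \<in> stell_cong n"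
proof -
  obtain w where w: "w \<in> lists {..<n}" "x = R0_class n w"
    using assms by (auto simp: carrier_R0)
  obtain w' where w': "w' \<in> lists {..<n}" "act_word (id_rook n) w' = St n (act_word (id_rook n) w)"
    "(R0_class n w, R0_class n w') \<in> stell_cong n"
    using stell_cong_St[OF w(1)] by blast
  have "St0 n x = R0_class n w'"
    using pi_rook_act_word[OF w'(1)] w w'(2) by (simp add: St0_def act_R0_class)
  then show ?thesis
    using w w' by simp
qed

text \<open>Elements are congruent to their images, so equal images force congruence; conversely
  \<open>St\<close> of the resulting rook is invariant under the congruence.\<close>

lemma St0_eq_iff:
  assumes "x \<in> carrier (R0 n)" "y \<in> carrier (R0 n)"
  shows "St0 n x = St0 n y \<longleftrightarrow> (x, y) \<in> stell_cong n"
proof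
  assume "St0 n x = St0 n y"
  then show "(x, y) \<in> stell_cong n"
    using St0_stell_cong assms by (metis mcong.sym mcong.trans)
next
  assume "(x, y) \<in> stell_cong n"
  then show "St0 n x = St0 n y"
    using St_act_stell_cong[OF _ id_rook_in_rooks] by (simp add: St0_def)
qed

lemma St0_in_carrier: "x \<in> carrier (R0 n) \<Longrightarrow> St0 n x \<in> carrier (R0 n)"
  using St0_stell_cong monoid.mcong_carrier[OF monoid_R0] by blast

lemma St0_mult:
  assumes "x \<in> carrier (R0 n)" "y \<in> carrier (R0 n)"
  shows "St0 n (St0 n x \<otimes>\<^bsub>R0 n\<^esub> St0 n y) = St0 n (x \<otimes>\<^bsub>R0 n\<^esub> y)"
proof -
  have "(St0 n x \<otimes>\<^bsub>R0 n\<^esub> St0 n y, x \<otimes>\<^bsub>R0 n\<^esub> y) \<in> stell_cong n"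
    using assms by (intro mcong.mult mcong.sym[OF St0_stell_cong])
  then show ?thesis
    using assms by (simp add: St0_eq_iff St0_in_carrier monoid.m_closed[OF monoid_R0])
qed

lemma St0_image: "St0 n ` carrier (R0 n) = pi_rook n ` Stell n"
proof -
  have "rooks n = act (id_rook n) ` carrier (R0 n)"
  proof
    show "rooks n \<subseteq> act (id_rook n) ` carrier (R0 n)"
    proof
      fix r assume "r \<in> rooks n"
      then obtain v where "v \<in> lists {..<n}" "act_word (id_rook n) v = r"
        by (rule reach_rook)
      then show "r \<in> act (id_rook n) ` carrier (R0 n)"
        using R0_class_in_carrier act_R0_class by (metis imageI length_id_rook)
    qed
  qed (use act_rooks id_rook_in_rooks in blast)
  then show ?thesis
    by (simp add: Stell_def St0_def image_image)
qed

theorem theorem4p39: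
  fixes n :: nat
  shows "monoid (R0 n) \<and> monoid (Stell0 n)
    \<and> St0 n \<in> hom (R0 n) (Stell0 n)
    \<and> St0 n \<one>\<^bsub>R0 n\<^esub> = \<one>\<^bsub>Stell0 n\<^esub>
    \<and> St0 n ` carrier (R0 n) = carrier (Stell0 n)
    \<and> (\<exists>\<phi>. \<phi> \<in> iso (quot_monoid (R0 n) (mcong (R0 n) (stell_rels n))) (Stell0 n)
         \<and> (\<forall>x \<in> carrier (R0 n). \<phi> (mcong (R0 n) (stell_rels n) `` {x}) = St0 n x))"
proof -
  interpret R: monoid "R0 n"
    by (rule monoid_R0)
  let ?C = "stell_cong n" and ?Q = "quot_monoid (R0 n) (stell_cong n)"
  have carrier: "carrier (Stell0 n) = St0 n ` carrier (R0 n)"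
    by (simp add: Stell0_def St0_image)
  have mult: "St0 n x \<otimes>\<^bsub>Stell0 n\<^esub> St0 n y = St0 n (x \<otimes>\<^bsub>R0 n\<^esub> y)"
    if "x \<in> carrier (R0 n)" "y \<in> carrier (R0 n)" for x y
    using that by (simp add: Stell0_def St0_mult)
  have one: "St0 n \<one>\<^bsub>R0 n\<^esub> = \<one>\<^bsub>Stell0 n\<^esub>"
    by (simp add: Stell0_def)
  have monoid: "monoid (Stell0 n)"
    by (rule monoidI) (auto simp: carrier mult R.m_assoc simp flip: one)
  have hom: "St0 n \<in> hom (R0 n) (Stell0 n)"
    by (auto simp: hom_def carrier mult)
  \<comment> \<open>\<open>St0\<close> is constant on each class, so the image of a class is a
    singleton.\<close>
  define \<phi> where "\<phi> A = the_elem (St0 n ` A)" for A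
  have \<phi>: "\<phi> (?C `` {x}) = St0 n x" if "x \<in> carrier (R0 n)" for x
  proof -
    have "St0 n y = St0 n x" if "y \<in> ?C `` {x}" for y
      using that \<open>x \<in> carrier (R0 n)\<close> St0_eq_iff[of x n y] R.mcong_carrier by auto
    moreover have "x \<in> ?C `` {x}"
      using that by (simp add: mcong.refl)
    ultimately have "St0 n ` (?C `` {x}) = {St0 n x}"
      by blast
    then show ?thesis
      by (simp add: \<phi>_def)
  qed
  have "\<phi> \<in> hom ?Q (Stell0 n)"
    by (auto simp: hom_def R.carrier_quot_monoid R.quot_monoid_mult \<phi> carrier mult)
  moreover have "bij_betw \<phi> (carrier ?Q) (carrier (Stell0 n))"
    unfolding bij_betw_def
  proof
    show "inj_on \<phi> (carrier ?Q)"
      by (auto simp: inj_on_def R.carrier_quot_monoid \<phi> St0_eq_iff R.mcong_class_eq_iff)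
    show "\<phi> ` carrier ?Q = carrier (Stell0 n)"
      by (simp add: R.carrier_quot_monoid carrier image_image \<phi>)
  qed
  ultimately have "\<phi> \<in> iso ?Q (Stell0 n)"
    by (simp add: iso_def)
  then show ?thesis
    using monoid_R0 monoid hom one carrier \<phi> by blast
qed

end
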